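(* Let $\mathcal{G}=(V,V_d,E)$ be a damping graph. The following statements are equivalent: (i) $\mathcal{G}$ is PI-GAS. (ii) There does not exist an assignment of colors (a coloring) that renders $\mathcal{G}$ richly balanced. (iii) $\mathcal{U}(\mathcal{G})=V$, i.e. every node of $\mathcal{G}$ is uncolorable.
   Context: Damping graph. A damping graph $\mathcal{G}=(V,V_d,E)$ is a finite simple connected undirected graph $(V,E)$ together with a nonempty set $V_d\subseteq V$ of damped nodes; $n=|V|$, $m=|E|$. PI-GAS. Fix an integer $r\ge1$, let $B\in\mathbb{R}^{n\times m}$ be an oriented incidence matrix of $(V,E)$ (each column has one $1$ and one $-1$, at the endpoints of the edge) and $\mathbb{B}=B\otimes I_r$. Feasible parameters are block diagonal matrices with $r\times r$ blocks $M=\mathrm{diag}(M_1,\dots,M_n)$, $W=\mathrm{diag}(W_1,\dots,W_m)$, $R=\mathrm{diag}(R_1,\dots,R_n)$, where all $M_i$ and $W_k$ are diagonal and positive definite, $R_i$ is symmetric positive definite for $i\in V_d$, and $R_i$ is symmetric positive semidefinite and singular (possibly zero) for $i\notin V_d$. Consider the linear system $$\dot p=-RM^{-1}p-\mathbb{B}Wq,\qquad \dot q=\mathbb{B}^TM^{-1}p$$ on the invariant subspace $\Omega=\{(p,q)\in\mathbb{R}^{rn}\times\mathbb{R}^{rm}: q\in\operatorname{im}(\mathbb{B}^T)\}$. $\mathcal{G}$ is parameter-independent globally asymptotically stable (PI-GAS) if for all feasible parameters $M,W,R$ the origin of this system on $\Omega$ is globally asymptotically stable. Colorings. A coloring of $\mathcal{G}$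 assigns to each node one of the colors black, red, blue, every damped node being black. A black node is poorly balanced if all its neighbors are black, richly balanced if it has at least one red and at least one blue neighbor, and unbalanced otherwise. The colored graph is poorly balanced if all nodes are black; richly balanced if it contains at least one richly balanced black node and no unbalanced black nodes; it is balanced if it is poorly or richly balanced. A node is uncolorable if it is black in every balanced colored graph of $\mathcal{G}$; $\mathcal{U}(\mathcal{G})$ denotes the set of uncolorable nodes. *)

theory Defs
  imports "HOL-Analysis.Analysis" "Graph_Theory.Digraph_Component"
begin

section \<open>Damping graphs\<close>

text \<open>
  Following Graph\_Theory, a finite simple undirected graph is a finite, loop-free, symmetric
  digraph (locale \<open>pair_graph\<close>), in which the undirected edge \<open>{u, v}\<close> is represented by the two
  arcs \<open>(u, v)\<close> and \<open>(v, u)\<close>.  The name \<open>connected\<close> is qualified because of the topological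
  notion of the same name.
\<close>

definition damping_graph :: "'v pair_pre_digraph \<Rightarrow> 'v set \<Rightarrow> bool" where
  "damping_graph G Vd \<longleftrightarrow>
     pair_graph G \<and> Digraph_Component.connected (with_proj G) \<and> Vd \<subseteq> pverts G \<and> Vd \<noteq> {}"

definition edges :: "'v pair_pre_digraph \<Rightarrow> 'v set set" where
  "edges G = {{u, v} | u v. (u, v) \<in> parcs G}"

definition neighbors :: "'v pair_pre_digraph \<Rightarrow> 'v \<Rightarrow> 'v set" where
  "neighbors G v = {w. (v, w) \<in> parcs G}"

section \<open>The linear system\<close>

text \<open>
  The matrix \<open>B\<close> has rows indexed by nodes and columns indexed by undirected edges; only its
  entries on \<open>pverts G\<close> and \<open>edges G\<close> matter.
\<close>

definition oriented_incidence_matrix ::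
    "'v pair_pre_digraph \<Rightarrow> ('v \<Rightarrow> 'v set \<Rightarrow> real) \<Rightarrow> bool" where
  "oriented_incidence_matrix G B \<longleftrightarrow>
     (\<forall>e\<in>edges G. \<exists>u v. e = {u, v} \<and> u \<noteq> v \<and> B u e = 1 \<and> B v e = -1 \<and>
        (\<forall>w\<in>pverts G - {u, v}. B w e = 0))"

text \<open>
  The type \<open>'r\<close> plays the role of the index set \<open>{1, \<dots>, r}\<close> with \<open>r = CARD('r) \<ge> 1\<close>.  A vector
  with one block in \<open>\<real>\<^sup>r\<close> per node (per edge) is a function from nodes (edges) to \<open>real ^ 'r\<close>, and
  a block diagonal matrix is the family of its diagonal \<open>r \<times> r\<close> blocks.  Values outside
  \<open>pverts G\<close> and \<open>edges G\<close> are irrelevant throughout.  The block of \<open>B \<otimes> I\<^sub>r\<close> at position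
  \<open>(v, e)\<close> is the multiple \<open>B v e\<close> of the identity, whence the next two definitions.
\<close>

definition kron_inc ::
    "'v pair_pre_digraph \<Rightarrow> ('v \<Rightarrow> 'v set \<Rightarrow> real) \<Rightarrow> ('v set \<Rightarrow> real ^ 'r) \<Rightarrow> 'v \<Rightarrow> real ^ 'r" where
  "kron_inc G B y = (\<lambda>v. \<Sum>e\<in>edges G. B v e *\<^sub>R y e)"

definition kron_inc_transpose ::
    "'v pair_pre_digraph \<Rightarrow> ('v \<Rightarrow> 'v set \<Rightarrow> real) \<Rightarrow> ('v \<Rightarrow> real ^ 'r) \<Rightarrow> 'v set \<Rightarrow> real ^ 'r" where
  "kron_inc_transpose G B x = (\<lambda>e. \<Sum>v\<in>pverts G. B v e *\<^sub>R x v)"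

definition block_diag_mult :: "('i \<Rightarrow> real ^ 'r ^ 'r) \<Rightarrow> ('i \<Rightarrow> real ^ 'r) \<Rightarrow> 'i \<Rightarrow> real ^ 'r" where
  "block_diag_mult D x = (\<lambda>i. D i *v x i)"

definition block_diag_inv :: "('i \<Rightarrow> real ^ 'r ^ 'r) \<Rightarrow> 'i \<Rightarrow> real ^ 'r ^ 'r" where
  "block_diag_inv D = (\<lambda>i. matrix_inv (D i))"

definition diagonal_matrix :: "real ^ 'r ^ 'r \<Rightarrow> bool" where
  "diagonal_matrix A \<longleftrightarrow> (\<forall>i j. i \<noteq> j \<longrightarrow> A $ i $ j = 0)"

definition sym_pos_def :: "real ^ 'r ^ 'r \<Rightarrow> bool" where
  "sym_pos_def A \<longleftrightarrow> transpose A = A \<and> (\<forall>x. x \<noteq> 0 \<longrightarrow> x \<bullet> (A *v x) > 0)"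

definition sym_pos_semidef :: "real ^ 'r ^ 'r \<Rightarrow> bool" where
  "sym_pos_semidef A \<longleftrightarrow> transpose A = A \<and> (\<forall>x. x \<bullet> (A *v x) \<ge> 0)"

definition feasible ::
    "'v pair_pre_digraph \<Rightarrow> 'v set \<Rightarrow> ('v \<Rightarrow> real ^ 'r ^ 'r) \<Rightarrow> ('v set \<Rightarrow> real ^ 'r ^ 'r) \<Rightarrow>
      ('v \<Rightarrow> real ^ 'r ^ 'r) \<Rightarrow> bool" where
  "feasible G Vd M W R \<longleftrightarrow>
     (\<forall>v\<in>pverts G. diagonal_matrix (M v) \<and> sym_pos_def (M v)) \<and>
     (\<forall>e\<in>edges G. diagonal_matrix (W e) \<and> sym_pos_def (W e)) \<and>
     (\<forall>v\<in>Vd. sym_pos_def (R v)) \<and>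
     (\<forall>v\<in>pverts G - Vd. sym_pos_semidef (R v) \<and> \<not> invertible (R v))"

type_synonym ('v, 'r) state = "('v \<Rightarrow> real ^ 'r) \<times> ('v set \<Rightarrow> real ^ 'r)"

definition Omega ::
    "'v pair_pre_digraph \<Rightarrow> ('v \<Rightarrow> 'v set \<Rightarrow> real) \<Rightarrow> ('v, 'r::finite) state set" where
  "Omega G B = {(p, q). \<exists>x. \<forall>e\<in>edges G. q e = kron_inc_transpose G B x e}"

definition state_norm :: "'v pair_pre_digraph \<Rightarrow> ('v, 'r::finite) state \<Rightarrow> real" where
  "state_norm G z =
     sqrt ((\<Sum>v\<in>pverts G. (norm (fst z v))\<^sup>2) + (\<Sum>e\<in>edges G. (norm (snd z e))\<^sup>2))"

text \<open>
  Solutions on \<open>[0, \<infinity>)\<close>, with derivatives taken componentwise and one-sided at time \<open>0\<close>.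
\<close>

definition is_solution ::
    "'v pair_pre_digraph \<Rightarrow> ('v \<Rightarrow> 'v set \<Rightarrow> real) \<Rightarrow> ('v \<Rightarrow> real ^ 'r ^ 'r) \<Rightarrow>
      ('v set \<Rightarrow> real ^ 'r ^ 'r) \<Rightarrow> ('v \<Rightarrow> real ^ 'r ^ 'r) \<Rightarrow> (real \<Rightarrow> ('v, 'r::finite) state) \<Rightarrow> bool" where
  "is_solution G B M W R z \<longleftrightarrow>
     (\<forall>t\<ge>0.
       (\<forall>v\<in>pverts G. ((\<lambda>s. fst (z s) v) has_vector_derivative
          (- block_diag_mult R (block_diag_mult (block_diag_inv M) (fst (z t))) v
           - kron_inc G B (block_diag_mult W (snd (z t))) v)) (at t within {0..})) \<and>
       (\<forall>e\<in>edges G. ((\<lambda>s. snd (z s) e) has_vector_derivative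
          kron_inc_transpose G B (block_diag_mult (block_diag_inv M) (fst (z t))) e)
          (at t within {0..})))"

text \<open>
  Global asymptotic stability of the origin: Lyapunov stability together with global
  attractivity, quantified over the set \<open>S\<close> of all solutions of the system.
\<close>

definition origin_GAS :: "('s \<Rightarrow> real) \<Rightarrow> (real \<Rightarrow> 's) set \<Rightarrow> bool" where
  "origin_GAS nrm S \<longleftrightarrow>
     (\<forall>\<epsilon>>0. \<exists>\<delta>>0. \<forall>z\<in>S. nrm (z 0) < \<delta> \<longrightarrow> (\<forall>t\<ge>0. nrm (z t) < \<epsilon>)) \<and>
     (\<forall>z\<in>S. ((\<lambda>t. nrm (z t)) \<longlongrightarrow> 0) at_top)"

text \<open>
  Since \<open>Omega G B\<close> is invariant, the solutions of the system on \<open>Omega G B\<close> are those which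
  start in it.
\<close>

definition PI_GAS ::
    "'r::finite itself \<Rightarrow> 'v pair_pre_digraph \<Rightarrow> 'v set \<Rightarrow> ('v \<Rightarrow> 'v set \<Rightarrow> real) \<Rightarrow> bool" where
  "PI_GAS r G Vd B \<longleftrightarrow>
     (\<forall>(M :: 'v \<Rightarrow> real ^ 'r ^ 'r) W R. feasible G Vd M W R \<longrightarrow>
        origin_GAS (state_norm G) {z. is_solution G B M W R z \<and> z 0 \<in> Omega G B})"

section \<open>Colorings\<close>

datatype color = Black | Red | Blue

definition coloring :: "'v set \<Rightarrow> ('v \<Rightarrow> color) \<Rightarrow> bool" where
  "coloring Vd c \<longleftrightarrow> (\<forall>v\<in>Vd. c v = Black)"

text \<open>The three predicates on nodes are meant for black nodes \<open>v\<close>.\<close>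

definition poorly_balanced_node :: "'v pair_pre_digraph \<Rightarrow> ('v \<Rightarrow> color) \<Rightarrow> 'v \<Rightarrow> bool" where
  "poorly_balanced_node G c v \<longleftrightarrow> (\<forall>w\<in>neighbors G v. c w = Black)"

definition richly_balanced_node :: "'v pair_pre_digraph \<Rightarrow> ('v \<Rightarrow> color) \<Rightarrow> 'v \<Rightarrow> bool" where
  "richly_balanced_node G c v \<longleftrightarrow>
     (\<exists>w\<in>neighbors G v. c w = Red) \<and> (\<exists>w\<in>neighbors G v. c w = Blue)"

definition unbalanced_node :: "'v pair_pre_digraph \<Rightarrow> ('v \<Rightarrow> color) \<Rightarrow> 'v \<Rightarrow> bool" where
  "unbalanced_node G c v \<longleftrightarrow> \<not> poorly_balanced_node G c v \<and> \<not> richly_balanced_node G c v"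

definition poorly_balanced :: "'v pair_pre_digraph \<Rightarrow> ('v \<Rightarrow> color) \<Rightarrow> bool" where
  "poorly_balanced G c \<longleftrightarrow> (\<forall>v\<in>pverts G. c v = Black)"

definition richly_balanced :: "'v pair_pre_digraph \<Rightarrow> ('v \<Rightarrow> color) \<Rightarrow> bool" where
  "richly_balanced G c \<longleftrightarrow>
     (\<exists>v\<in>pverts G. c v = Black \<and> richly_balanced_node G c v) \<and>
     \<not> (\<exists>v\<in>pverts G. c v = Black \<and> unbalanced_node G c v)"

definition balanced :: "'v pair_pre_digraph \<Rightarrow> ('v \<Rightarrow> color) \<Rightarrow> bool" where
  "balanced G c \<longleftrightarrow> poorly_balanced G c \<or> richly_balanced G c"

definition uncolorable :: "'v pair_pre_digraph \<Rightarrow> 'v set \<Rightarrow> 'v set" where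
  "uncolorable G Vd = {v \<in> pverts G. \<forall>c. coloring Vd c \<and> balanced G c \<longrightarrow> c v = Black}"

end

theory Submission
  imports Defs
begin

text \<open>
  Both directions go through real vectors \<open>f \<noteq> 0\<close> on the nodes that vanish on the damped nodes and
  satisfy \<open>L f = \<mu> M f\<close> for the weighted graph Laplacian \<open>L = B W B\<^sup>T\<close>. The sign pattern of such an \<open>f\<close>
  is richly balanced: at a zero of \<open>f\<close> the equation says that the positively weighted sum of the
  neighboring values is zero. Conversely, a richly balanced coloring is the sign pattern of some
  \<open>f\<close> for suitable weights and masses with \<open>\<mu> = 1\<close>, and \<open>p = cos t M f\<close>, \<open>q = sin t B\<^sup>T f\<close> is then an
  undamped oscillation.

  If a solution does not converge to \<open>0\<close>, take a nonzero limit point of it in \<open>Omega\<close>. The energy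
  dissipation tends to \<open>0\<close> along every solution, in particular along all time derivatives of the given
  one, so all iterates of the vector field at the limit point are free of dissipation. Hence some scalar
  component generates a subspace of vectors vanishing on the damped nodes and invariant under \<open>M\<^sup>-\<^sup>1 L\<close>,
  which is self-adjoint for the inner product weighted by \<open>M\<close>; it therefore has an eigenvector in that
  subspace.
\<close>

section \<open>Finite connected graphs\<close>

locale connected_graph =
  fixes G :: "'v pair_pre_digraph" and Vd :: "'v set"
  assumes damping: "damping_graph G Vd"
begin

sublocale pair_graph G
  using damping by (simp add: damping_graph_def)

lemma damped: "Vd \<subseteq> pverts G" "Vd \<noteq> {}"
  using damping by (auto simp: damping_graph_def)

lemma finite_neighbors: "finite (neighbors G v)"
  by (rule finite_subset[OF _ pair_finite_verts]) (auto simp: neighbors_def dest: in_arcsD2)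

lemma finite_edges: "finite (edges G)"
proof -
  have "edges G = (\<lambda>(u, v). {u, v}) ` parcs G"
    by (auto simp: edges_def image_iff)
  then show ?thesis
    using pair_finite_arcs by simp
qed

lemma sym_parcs: "(u, v) \<in> parcs G \<longleftrightarrow> (v, u) \<in> parcs G"
  using pair_sym_arcs unfolding symmetric_def sym_def with_proj_simps by blast

lemma neighborD:
  assumes "u \<in> neighbors G v"
  shows "u \<in> pverts G" "v \<in> pverts G" "u \<noteq> v" "v \<in> neighbors G u" "{v, u} \<in> edges G"
    "(v, u) \<in> parcs G"
  using assms sym_parcs[of v u] in_arcsD1 in_arcsD2 pair_no_loops[of "(v, u)"]
  by (auto simp: neighbors_def edges_def)

text \<open>Connectedness is defined through the symmetric closure of the digraph. The arcs are
  already symmetric, so the closure adds none.\<close>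

lemma parcs_rtrancl:
  assumes "u \<in> pverts G" "v \<in> pverts G"
  shows "(u, v) \<in> (parcs G)\<^sup>*"
proof -
  have "strongly_connected (with_proj (mk_symmetric (with_proj G)))"
    using damping by (simp add: damping_graph_def Digraph_Component.connected_def)
  then have "u \<rightarrow>\<^sup>*\<^bsub>with_proj (mk_symmetric (with_proj G))\<^esub> v"
    using assms by (simp add: strongly_connected_def)
  then have "(u, v) \<in> (parcs (mk_symmetric (with_proj G)))\<^sup>*"
    using reachable_rtranclI by fastforce
  moreover have "parcs (mk_symmetric (with_proj G)) = parcs G"
    by (auto simp: parcs_mk_symmetric sym_parcs)
  ultimately show ?thesis
    by simp
qed

text \<open>The form in which connectedness is used later: a walk from \<open>u\<close> to
  \<open>v\<close> has to leave \<open>P\<close> along some arc.\<close>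

lemma boundary_arc:
  assumes "u \<in> pverts G" "P u" "v \<in> pverts G" "\<not> P v"
  obtains a b where "b \<in> neighbors G a" "P a" "\<not> P b"
proof -
  have "(u, v) \<in> (parcs G)\<^sup>*"
    using assms by (intro parcs_rtrancl)
  then have "P v \<or> (\<exists>a b. (a, b) \<in> parcs G \<and> P a \<and> \<not> P b)"
    by induction (use assms in blast)+
  then show ?thesis
    using assms that by (auto simp: neighbors_def)
qed

text \<open>A richly balanced coloring contains a red node, which is then not uncolorable. Without
  such colorings only the all-black one is balanced.\<close>

lemma uncolorable_eq_pverts_iff:
  "uncolorable G Vd = pverts G \<longleftrightarrow> \<not> (\<exists>c. coloring Vd c \<and> richly_balanced G c)"
proof
  assume unc: "uncolorable G Vd = pverts G"
  show "\<not> (\<exists>c. coloring Vd c \<and> richly_balanced G c)"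
  proof
    assume "\<exists>c. coloring Vd c \<and> richly_balanced G c"
    then obtain c v w where c: "coloring Vd c" "richly_balanced G c" and w: "w \<in> neighbors G v" "c w = Red"
      unfolding richly_balanced_def richly_balanced_node_def by blast
    then have "w \<in> uncolorable G Vd"
      using unc neighborD by auto
    then show False
      using c w by (auto simp: uncolorable_def balanced_def)
  qed
next
  assume "\<not> (\<exists>c. coloring Vd c \<and> richly_balanced G c)"
  then show "uncolorable G Vd = pverts G"
    by (auto simp: uncolorable_def balanced_def poorly_balanced_def)
qed

section \<open>The weighted Laplacian and sign patterns\<close>

definition laplacian :: "('v set \<Rightarrow> real) \<Rightarrow> ('v \<Rightarrow> real) \<Rightarrow> 'v \<Rightarrow> real" where
  "laplacian w f v = (\<Sum>u\<in>neighbors G v. w {v, u} * (f v - f u))"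

lemma sign_coloring_richly_balanced:
  assumes wpos: "\<And>e. e \<in> edges G \<Longrightarrow> w e > 0"
    and nz: "\<exists>v\<in>pverts G. f v \<noteq> 0" and damp: "\<And>v. v \<in> Vd \<Longrightarrow> f v = 0"
    and lap: "\<And>v. v \<in> pverts G \<Longrightarrow> f v = 0 \<Longrightarrow> laplacian w f v = 0"
  shows "\<exists>c. coloring Vd c \<and> richly_balanced G c"
proof -
  define c where "c v = (if f v = 0 then Black else if f v > 0 then Red else Blue)" for v
  have cB: "c v = Black \<longleftrightarrow> f v = 0" and cR: "c v = Red \<longleftrightarrow> f v > 0" and cL: "c v = Blue \<longleftrightarrow> f v < 0" for v
    by (auto simp: c_def)
  have bal: "richly_balanced_node G c v"
    if v: "v \<in> pverts G" "f v = 0" and u: "u \<in> neighbors G v" "f u \<noteq> 0" for u v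
  proof -
    have s: "(\<Sum>x\<in>neighbors G v. w {v, x} * f x) = 0"
      using lap[OF v] v by (simp add: laplacian_def sum_negf)
    have w: "w {v, x} > 0" if "x \<in> neighbors G v" for x
      using that by (intro wpos neighborD(5))
    \<comment> \<open>Used below for \<open>f\<close> and for \<open>- f\<close>: if the neighboring
      values had only one sign, the nonzero value at \<open>u\<close> would contradict
      \<open>s\<close>.\<close>
    have pos: "(\<Sum>x\<in>neighbors G v. w {v, x} * g x) > 0"
      if g: "\<And>x. x \<in> neighbors G v \<Longrightarrow> g x \<ge> 0" "g u \<noteq> 0" for g
    proof (rule sum_pos2[OF finite_neighbors u(1)])
      show "0 < w {v, u} * g u"
        using w[OF u(1)] g(1)[OF u(1)] g(2) by simp
      show "0 \<le> w {v, x} * g x" if "x \<in> neighbors G v" for x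
        using w[OF that] g(1)[OF that] by simp
    qed
    have "\<exists>x\<in>neighbors G v. f x > 0"
      using pos[of "\<lambda>x. - f x"] u s by (force simp: sum_negf)
    moreover have "\<exists>x\<in>neighbors G v. f x < 0"
      using pos[of f] u s by force
    ultimately show ?thesis
      unfolding richly_balanced_node_def cR cL by blast
  qed
  obtain d where d: "d \<in> Vd"
    using damped by blast
  obtain v where v: "v \<in> pverts G" "f v \<noteq> 0"
    using nz by blast
  \<comment> \<open>A walk from a damped node to a node with nonzero value leaves the zero set. This
    yields a black node with a colored neighbor.\<close>
  obtain a b where ab: "b \<in> neighbors G a" "f a = 0" "f b \<noteq> 0"
  proof (rule boundary_arc[of d "\<lambda>x. f x = 0" v])
    show "d \<in> pverts G" "f d = 0"
      using d damped damp by auto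
  qed (use v that in auto)
  have "richly_balanced_node G c a"
    using ab neighborD bal by blast
  moreover have "\<not> unbalanced_node G c x" if "x \<in> pverts G" "c x = Black" for x
    using bal that unfolding unbalanced_node_def poorly_balanced_node_def cB by blast
  ultimately have "richly_balanced G c"
    using ab neighborD unfolding richly_balanced_def cB by blast
  then show ?thesis
    using damp by (intro exI[of _ c]) (simp add: coloring_def cB)
qed

section \<open>Eigenvectors from richly balanced colorings\<close>

text \<open>\<open>d\<close> is the graph distance to the nodes satisfying \<open>P\<close>. The
  second property extends a shortest walk by one arc, the third removes its last arc.\<close>

lemma level_function:
  assumes "b \<in> pverts G" "P b"
  obtains d :: "'v \<Rightarrow> nat" where
    "\<And>v. v \<in> pverts G \<Longrightarrow> d v = 0 \<longleftrightarrow> P v"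
    "\<And>u v. u \<in> neighbors G v \<Longrightarrow> d u \<le> Suc (d v)"
    "\<And>v. v \<in> pverts G \<Longrightarrow> \<not> P v \<Longrightarrow> \<exists>u\<in>neighbors G v. d v = Suc (d u)"
proof -
  define Q where "Q v k \<longleftrightarrow> (\<exists>b\<in>pverts G. P b \<and> (b, v) \<in> parcs G ^^ k)" for v k
  define d where "d v = (LEAST k. Q v k)" for v
  have Q: "Q v (d v)" if v: "v \<in> pverts G" for v
  proof -
    obtain k where "(b, v) \<in> parcs G ^^ k"
      using parcs_rtrancl[OF assms(1) v] rtrancl_imp_relpow by blast
    then have "Q v k"
      using assms by (auto simp: Q_def)
    then show ?thesis
      unfolding d_def by (rule LeastI)
  qed
  have le: "d v \<le> k" if "Q v k" for v k
    unfolding d_def using that by (rule Least_le)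
  have 1: "d v = 0 \<longleftrightarrow> P v" if "v \<in> pverts G" for v
    using Q[OF that] le[of v 0] that by (auto simp: Q_def)
  have 2: "d u \<le> Suc (d v)" if "u \<in> neighbors G v" for u v
    using Q[of v] neighborD[OF that] by (intro le) (auto simp: Q_def)
  have 3: "\<exists>u\<in>neighbors G v. d v = Suc (d u)" if v: "v \<in> pverts G" "\<not> P v" for v
  proof -
    obtain k where k: "d v = Suc k"
      using 1[OF v(1)] v(2) by (cases "d v") auto
    then have "Q v (Suc k)"
      using Q[OF v(1)] by simp
    then obtain u where u: "Q u k" "(u, v) \<in> parcs G"
      by (auto simp: Q_def)
    then have uv: "u \<in> neighbors G v"
      by (simp add: neighbors_def sym_parcs)
    then have "d v \<le> Suc (d u)"
      using 2 neighborD by blast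
    then have "d v = Suc (d u)"
      using le[OF u(1)] k by simp
    then show ?thesis
      using uv by blast
  qed
  show thesis
    using 1 2 3 by (rule that)
qed

text \<open>Weights are indexed by edges as sets, but are easier to define from the two endpoints;
  symmetry makes the passage well defined.\<close>

lemma symmetric_weights:
  assumes "\<And>u v. \<omega> u v = \<omega> v u"
  obtains w :: "'v set \<Rightarrow> real" where "\<And>u v. w {u, v} = \<omega> u v"
proof -
  define w where "w e = (THE r. \<exists>u v. e = {u, v} \<and> r = \<omega> u v)" for e
  have "w {u, v} = \<omega> u v" for u v
    unfolding w_def by (rule the_equality) (auto simp: doubleton_eq_iff assms)
  then show thesis
    by (rule that)
qed

text \<open>
  The eigenvector is \<open>\<plusminus>d\<close>, where \<open>d\<close> is the distance to the set of black nodes. The edges from a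
  black node to its neighbors of one color have total weight \<open>1\<close>, and the weights between
  consecutive distances decrease so fast that at a colored node the edge towards the black nodes
  dominates the Laplacian; the masses \<open>m\<close> are then read off the eigenvalue equation.
\<close>

lemma richly_balanced_eigenvector:
  assumes col: "coloring Vd c" and rich: "richly_balanced G c"
  shows "\<exists>w m f. (\<forall>e\<in>edges G. w e > (0 :: real)) \<and> (\<forall>v\<in>pverts G. m v > (0 :: real)) \<and>
    (\<forall>v\<in>pverts G. laplacian w f v = m v * f v) \<and> (\<exists>v\<in>pverts G. f v \<noteq> 0) \<and> (\<forall>v\<in>Vd. f v = 0)"
proof -
  obtain b0 where "b0 \<in> pverts G" "c b0 = Black"
    using rich by (auto simp: richly_balanced_def)
  from level_function[of b0 "\<lambda>v. c v = Black", OF this]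
  obtain d :: "'v \<Rightarrow> nat" where d0: "\<And>v. v \<in> pverts G \<Longrightarrow> d v = 0 \<longleftrightarrow> c v = Black"
    and d1: "\<And>u v. u \<in> neighbors G v \<Longrightarrow> d u \<le> Suc (d v)"
    and d2: "\<And>v. v \<in> pverts G \<Longrightarrow> c v \<noteq> Black \<Longrightarrow> \<exists>u\<in>neighbors G v. d v = Suc (d u)"
    by blast
  define n where "n = card (pverts G)"
  define same where "same v u = {a \<in> neighbors G v. c a = c u}" for v u
  \<comment> \<open>Edges within a level never pull a node towards zero, so weight \<open>1\<close>
    is harmless. At a black endpoint, the neighbors of each color share weight \<open>1\<close>
    equally. An edge between levels \<open>k\<close> and \<open>k + 1\<close> with
    \<open>k > 0\<close> gets weight \<open>1 / n ^ (k + 1)\<close>.\<close>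
  define \<omega> where "\<omega> u v = (if d u = d v then 1 else if d u = 0 then 1 / card (same u v)
     else if d v = 0 then 1 / card (same v u) else 1 / real n ^ (Suc (min (d u) (d v))))" for u v
  have "\<omega> u v = \<omega> v u" for u v
    by (auto simp: \<omega>_def min.commute)
  then obtain w :: "'v set \<Rightarrow> real" where w: "\<And>u v. w {u, v} = \<omega> u v"
    using symmetric_weights[of \<omega>] by blast
  have n: "n > 0"
    using damped pair_finite_verts by (auto simp: n_def card_gt_0_iff)
  have same_pos: "card (same v u) > 0" if "u \<in> neighbors G v" for u v
    using that finite_neighbors[of v] by (auto simp: same_def card_gt_0_iff)
  have nbr_less: "card (neighbors G v) < n" if "v \<in> pverts G" for v
    unfolding n_def using pair_finite_verts neighborD that by (intro psubset_card_mono) blast+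
  have same_le: "card (same v u) \<le> n" if "v \<in> pverts G" for u v
  proof -
    have "card (same v u) \<le> card (neighbors G v)"
      unfolding same_def using finite_neighbors by (intro card_mono) auto
    then show ?thesis
      using nbr_less[OF that] by simp
  qed
  have \<omega>_pos: "\<omega> v u > 0" if "u \<in> neighbors G v" for u v
    using that n same_pos[OF that] same_pos[of v u] neighborD(4)[OF that] by (auto simp: \<omega>_def intro!: same_pos)
  have wpos: "w e > 0" if "e \<in> edges G" for e
    using that \<omega>_pos by (auto simp: edges_def w neighbors_def)
  define f where "f v = (case c v of Black \<Rightarrow> 0 | Red \<Rightarrow> real (d v) | Blue \<Rightarrow> - real (d v))" for v
  have f0: "f v \<noteq> 0 \<longleftrightarrow> c v \<noteq> Black" if "v \<in> pverts G" for v
    using d0[OF that] by (auto simp: f_def split: color.splits)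
  have black: "laplacian w f v = 0" if v: "v \<in> pverts G" "c v = Black" for v
  proof -
    have dv: "d v = 0"
      using d0 v by blast
    let ?N = "\<lambda>k. {a \<in> neighbors G v. c a = k}"
    \<comment> \<open>A colored neighbor of a black node has distance exactly \<open>1\<close>, so
      \<open>f\<close> is \<open>1\<close> or \<open>-1\<close> there. Each color present thus
      contributes total modulus \<open>1\<close>, and the two colors cancel.\<close>
    have "w {v, u} * (f v - f u) = (if c u = Red then - 1 / card (?N Red) else 0)
        + (if c u = Blue then 1 / card (?N Blue) else 0)"
      if u: "u \<in> neighbors G v" for u
    proof (cases "c u = Black")
      case False
      then have "d u = 1"
        using d1[OF u] d0[OF neighborD(1)[OF u]] dv by auto
      then show ?thesis
        using False v dv by (cases "c u") (auto simp: w \<omega>_def f_def same_def)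
    qed (use v in \<open>simp add: f_def\<close>)
    then have "laplacian w f v = (\<Sum>u\<in>?N Red. - 1 / card (?N Red)) + (\<Sum>u\<in>?N Blue. 1 / card (?N Blue))"
      unfolding laplacian_def sum.inter_filter[OF finite_neighbors] sum.distrib[symmetric]
      by (rule sum.cong[OF refl])
    also have "\<dots> = 0"
    proof (cases "poorly_balanced_node G c v")
      case True
      then have "?N Red = {}" "?N Blue = {}"
        by (auto simp: poorly_balanced_node_def)
      then show ?thesis
        by (simp only:) simp
    next
      case False
      then have "richly_balanced_node G c v"
        using rich v by (auto simp: richly_balanced_def unbalanced_node_def)
      then have "card (?N Red) > 0" "card (?N Blue) > 0"
        using finite_neighbors[of v] by (auto simp: card_gt_0_iff richly_balanced_node_def)
      then show ?thesis
        by simp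
    qed
    finally show ?thesis .
  qed
  have colored: "laplacian w f v / f v > 0" if v: "v \<in> pverts G" "c v \<noteq> Black" for v
  proof -
    \<comment> \<open>\<open>s\<close> is the sign of \<open>f v\<close>; multiplying by it treats
      red and blue nodes together.\<close>
    define s :: real where "s = (if c v = Red then 1 else -1)"
    have sf: "s * f v = d v" and s: "s = 1 \<or> s = -1"
      using v by (auto simp: s_def f_def split: color.splits)
    have abs_f: "\<bar>f u\<bar> \<le> d u" for u
      by (auto simp: f_def split: color.splits)
    have dv: "d v > 0"
      using d0 v by blast
    define t where "t u = w {v, u} * (s * (f v - f u))" for u
    have diff: "s * (f v - f u) \<ge> real (d v) - real (d u)" for u
      using abs_f[of u] sf s by (auto simp: right_diff_distrib)
    \<comment> \<open>The weight of an edge from \<open>v\<close> to the next higher level. Only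
      such edges contribute negatively to \<open>s * laplacian w f v\<close>, each by at least
      \<open>- \<epsilon>\<close>. The edge to a lower level contributes at least
      \<open>n * \<epsilon>\<close>, which outweighs the fewer than \<open>n\<close> remaining
      neighbors.\<close>
    define \<epsilon> where "\<epsilon> = 1 / real n ^ Suc (d v)"
    have \<epsilon>: "\<epsilon> > 0"
      using n by (simp add: \<epsilon>_def)
    have t_ge: "t u \<ge> - \<epsilon>" if u: "u \<in> neighbors G v" for u
    proof (cases "d u \<le> d v")
      case True
      then have "t u \<ge> 0"
        unfolding t_def using diff[of u] \<omega>_pos[OF u] by (intro mult_nonneg_nonneg[of "w {v, u}"]) (simp_all add: w)
      then show ?thesis
        using \<epsilon> by simp
    next
      case False
      then have du: "d u = Suc (d v)"
        using d1[OF u] by simp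
      have "w {v, u} * (-1) \<le> t u"
        unfolding t_def using diff[of u] du \<omega>_pos[OF u] by (intro mult_left_mono) (auto simp: w)
      then show ?thesis
        using du dv by (simp add: w \<omega>_def \<epsilon>_def)
    qed
    obtain u where u: "u \<in> neighbors G v" "d v = Suc (d u)"
      using d2 v by blast
    have "1 / real n ^ d v \<le> w {v, u}"
    proof (cases "d u = 0")
      case True
      have "1 / real n \<le> 1 / card (same u v)"
        using same_le[OF neighborD(1)[OF u(1)], of v] same_pos[OF neighborD(4)[OF u(1)]]
        by (simp add: frac_le)
      then show ?thesis
        using True u(2) by (simp add: w \<omega>_def)
    next
      case False
      then show ?thesis
        using u(2) by (simp add: w \<omega>_def)
    qed
    also have "w {v, u} * 1 \<le> t u"
      unfolding t_def using diff[of u] u(2) \<omega>_pos[OF u(1)] by (intro mult_left_mono) (auto simp: w)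
    finally have tu: "t u \<ge> real n * \<epsilon>"
      using n by (simp add: \<epsilon>_def)
    have "card (neighbors G v - {u}) < n"
      using nbr_less[OF v(1)] card_mono[OF finite_neighbors[of v], of "neighbors G v - {u}"] by simp
    then have "0 < real n * \<epsilon> - real (card (neighbors G v - {u})) * \<epsilon>"
      using \<epsilon> by simp
    also have "\<dots> = real n * \<epsilon> + (\<Sum>x\<in>neighbors G v - {u}. - \<epsilon>)"
      by simp
    also have "\<dots> \<le> t u + (\<Sum>x\<in>neighbors G v - {u}. t x)"
      using tu t_ge by (intro add_mono sum_mono) auto
    also have "\<dots> = (\<Sum>x\<in>neighbors G v. t x)"
      using u finite_neighbors by (intro sum.remove[symmetric])
    also have "\<dots> = s * laplacian w f v"
      by (simp add: laplacian_def t_def sum_distrib_left mult_ac)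
    finally have "s * laplacian w f v > 0" .
    then show ?thesis
      using sf dv s by (auto simp: zero_less_divide_iff)
  qed
  \<comment> \<open>At a black node both sides of the eigenvalue equation vanish, so any positive
    mass would do.\<close>
  define m where "m v = (if c v = Black then 1 else laplacian w f v / f v)" for v
  have mpos: "m v > 0" if "v \<in> pverts G" for v
    using colored that by (simp add: m_def)
  have lap: "laplacian w f v = m v * f v" if "v \<in> pverts G" for v
    using black[OF that] f0[OF that] by (auto simp: m_def f_def)
  have nz: "\<exists>v\<in>pverts G. f v \<noteq> 0"
  proof -
    obtain v u where "u \<in> neighbors G v" "c u = Red"
      using rich by (auto simp: richly_balanced_def richly_balanced_node_def)
    then show ?thesis
      using f0 neighborD(1) by (metis color.distinct(1))
  qed
  have damped0: "f v = 0" if "v \<in> Vd" for v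
    using col that by (auto simp: coloring_def f_def)
  show ?thesis
    by (intro exI[of _ w] exI[of _ m] exI[of _ f] conjI ballI nz) (fact wpos mpos lap damped0)+
qed

end

section \<open>Eigenvectors in invariant subspaces\<close>

text \<open>Tychonoff's theorem. It gives compactness of the unit sphere of a space of functions on
  the whole node type.\<close>

lemma compact_box:
  assumes "\<And>v. compact (X v)"
  shows "compact {f :: 'a \<Rightarrow> 'b :: topological_space. \<forall>v. f v \<in> X v}"
proof -
  have "compactin (product_topology (\<lambda>_. euclidean) UNIV) (PiE UNIV X)"
    unfolding compactin_PiE using assms by simp
  moreover have "PiE UNIV X = {f. \<forall>v. f v \<in> X v}"
    by (auto simp: PiE_def)
  ultimately show ?thesis
    by (simp add: euclidean_product_topology)
qed

text \<open>For small positive \<open>t\<close> the linear term beats the quadratic one. This is the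
  first-order condition at an extremum of a quadratic form.\<close>

lemma linear_le_quadratic_imp_zero:
  fixes a C :: real
  assumes "\<And>t. 2 * t * a \<le> t\<^sup>2 * C" and "a \<ge> 0"
  shows "a = 0"
proof (rule ccontr)
  assume "a \<noteq> 0"
  then have pos: "a > 0"
    using assms by simp
  \<comment> \<open>A positive upper bound of \<open>C\<close>, which makes \<open>a / E\<close> an
    admissible small value of \<open>t\<close>.\<close>
  define E where "E = \<bar>C\<bar> + 1"
  have E: "E > 0" "C \<le> E"
    by (auto simp: E_def)
  have "2 * (a / E) * a \<le> (a / E)\<^sup>2 * E"
    by (rule order_trans[OF assms(1)]) (intro mult_left_mono E(2), simp)
  also have "\<dots> = (a / E) * a"
    using E by (simp add: power2_eq_square)
  finally show False
    using pos E by (simp add: field_simps)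
qed

text \<open>A maximizer of the Rayleigh quotient over the subspace is an eigenvector.\<close>

lemma self_adjoint_eigenvector:
  fixes S :: "('v \<Rightarrow> real) \<Rightarrow> 'v \<Rightarrow> real" and m :: "'v \<Rightarrow> real"
  assumes fin: "finite V" and m: "\<And>v. v \<in> V \<Longrightarrow> m v > 0"
    and lin: "\<And>a b f g. S (\<lambda>v. a * f v + b * g v) = (\<lambda>v. a * S f v + b * S g v)"
    and cont: "continuous_on UNIV S"
    and sym: "\<And>f g. (\<Sum>v\<in>V. m v * f v * S g v) = (\<Sum>v\<in>V. m v * S f v * g v)"
    and K: "closed K" "\<And>a b f g. f \<in> K \<Longrightarrow> g \<in> K \<Longrightarrow> (\<lambda>v. a * f v + b * g v) \<in> K"
      "\<And>f. f \<in> K \<Longrightarrow> S f \<in> K" "\<And>f. f \<in> K \<Longrightarrow> \<forall>v. v \<notin> V \<longrightarrow> f v = 0"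
    and u: "u \<in> K" "\<exists>v\<in>V. u v \<noteq> 0"
  obtains f \<mu> where "f \<in> K" "\<exists>v\<in>V. f v \<noteq> 0" "\<And>v. v \<in> V \<Longrightarrow> S f v = \<mu> * f v"
proof -
  define ip where "ip f g = (\<Sum>v\<in>V. m v * f v * g v)" for f g
  have ip_comm: "ip f g = ip g f" for f g
    unfolding ip_def by (simp add: mult_ac)
  have ip_lin: "ip (\<lambda>v. a * f v + b * g v) h = a * ip f h + b * ip g h" for a b f g h
    unfolding ip_def by (simp add: algebra_simps sum.distrib sum_distrib_left)
  have ip_lin': "ip h (\<lambda>v. a * f v + b * g v) = a * ip h f + b * ip h g" for a b f g h
    using ip_lin ip_comm by metis
  have ip_S: "ip f (S g) = ip (S f) g" for f g
    unfolding ip_def by (rule sym)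
  have ip_ge: "ip f f \<ge> 0" for f
    unfolding ip_def by (intro sum_nonneg) (simp add: mult.assoc less_imp_le[OF m])
  have ip_0: "f v = 0" if "ip f f = 0" "v \<in> V" for f v
  proof -
    have "\<forall>v\<in>V. m v * f v * f v = 0"
      using that fin unfolding ip_def
      by (subst (asm) sum_nonneg_eq_0_iff) (simp_all add: mult.assoc less_imp_le[OF m])
    then show ?thesis
      using that m by force
  qed
  have coord: "continuous_on UNIV (\<lambda>f. F f v)" if "continuous_on UNIV F"
    for F :: "('v \<Rightarrow> real) \<Rightarrow> 'v \<Rightarrow> real" and v
    using that by (rule continuous_on_product_then_coordinatewise)
  have cont_ip: "continuous_on UNIV (\<lambda>f. ip (F f) (F' f))"
    if "continuous_on UNIV F" "continuous_on UNIV F'"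
    for F F' :: "('v \<Rightarrow> real) \<Rightarrow> 'v \<Rightarrow> real"
    unfolding ip_def by (intro continuous_intros coord[OF that(1)] coord[OF that(2)])
  define T where "T = K \<inter> {f. ip f f = 1}"
  \<comment> \<open>On the unit sphere \<open>m v * (f v)\<^sup>2 \<le> 1\<close>, and
    \<open>\<bar>x\<bar> \<le> 1 + x\<^sup>2\<close> turns this into a bound on \<open>f v\<close>
    without roots. Outside \<open>V\<close> the elements of \<open>K\<close> vanish, hence the
    factor \<open>{0}\<close>.\<close>
  define X where "X v = (if v \<in> V then {- (1 + 1 / m v)..1 + 1 / m v} else {0})" for v
  have "closed {f. ip f f = 1}"
    by (rule closed_Collect_eq[OF cont_ip[OF continuous_on_id continuous_on_id] continuous_on_const])
  then have "closed T"
    unfolding T_def using K by blast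
  moreover have "T \<subseteq> {f. \<forall>v. f v \<in> X v}"
  proof clarify
    fix f v assume f: "f \<in> T"
    show "f v \<in> X v"
    proof (cases "v \<in> V")
      case True
      have "m v * f v * f v \<le> ip f f"
        unfolding ip_def using fin True m by (intro member_le_sum) (auto simp: mult.assoc less_imp_le)
      then have "(f v)\<^sup>2 \<le> 1 / m v"
        using f m[OF True] by (simp add: T_def field_simps power2_eq_square)
      moreover have "\<bar>f v\<bar> \<le> 1 + (f v)\<^sup>2"
        using sum_power2_ge_zero[of "\<bar>f v\<bar> - 1" "f v"] zero_le_power2[of "\<bar>f v\<bar> - 1"]
        by (simp add: power2_diff)
      ultimately show ?thesis
        using True by (auto simp: X_def)
    next
      case False
      then show ?thesis
        using K(4) f by (auto simp: X_def T_def)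
    qed
  qed
  moreover have "compact {f. \<forall>v. f v \<in> X v}"
    by (rule compact_box) (auto simp: X_def)
  ultimately have "compact T"
    by (metis compact_Int_closed inf.absorb_iff2)
  have normalize: "(\<lambda>v. 1 / sqrt (ip g g) * g v + 0 * g v) \<in> T" if "g \<in> K" "ip g g > 0" for g
  proof -
    let ?a = "1 / sqrt (ip g g)"
    have "ip (\<lambda>v. ?a * g v + 0 * g v) (\<lambda>v. ?a * g v + 0 * g v) = (?a * ?a) * ip g g"
      unfolding ip_lin ip_lin' by simp
    also have "\<dots> = 1"
      using that(2) by simp
    finally show ?thesis
      using K(2)[OF that(1) that(1)] by (simp only: T_def Int_iff mem_Collect_eq simp_thms)
  qed
  have ip_pos: "ip g g > 0" if "g v \<noteq> 0" "v \<in> V" for g v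
    using ip_ge[of g] ip_0[of g v] that by force
  have "T \<noteq> {}"
    using normalize u ip_pos by blast
  moreover have "continuous_on T (\<lambda>f. ip f (S f))"
    by (rule continuous_on_subset[OF cont_ip]) (auto intro: cont continuous_on_id)
  ultimately obtain f where f: "f \<in> T" and max: "\<And>g. g \<in> T \<Longrightarrow> ip g (S g) \<le> ip f (S f)"
    using continuous_attains_sup[OF \<open>compact T\<close>] by blast
  define \<mu> where "\<mu> = ip f (S f)"
  have fK: "f \<in> K" and f1: "ip f f = 1"
    using f by (auto simp: T_def)
  have Q: "ip g (S g) \<le> \<mu> * ip g g" if "g \<in> K" for g
  proof (cases "ip g g = 0")
    case True
    have "ip g (S g) = 0"
      unfolding ip_def using ip_0[OF True] by (intro sum.neutral) simp
    then show ?thesis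
      using True by simp
  next
    case False
    then have pos: "ip g g > 0"
      using ip_ge[of g] by simp
    have "ip g (S g) / ip g g \<le> \<mu>"
      using max[OF normalize[OF that pos]] pos unfolding lin ip_lin ip_lin' \<mu>_def[symmetric] by simp
    then show ?thesis
      using pos by (simp add: divide_le_eq)
  qed
  \<comment> \<open>The residual of the eigenvalue equation. Inserting \<open>f + t h\<close> into
    the Rayleigh inequality \<open>Q\<close> gives a linear term \<open>2 * t * ip h h\<close>
    bounded by a multiple of \<open>t\<^sup>2\<close>, so \<open>h\<close> vanishes on
    \<open>V\<close>.\<close>
  define h where "h = (\<lambda>v. 1 * S f v + (- \<mu>) * f v)"
  have hK: "h \<in> K"
    unfolding h_def using K(2)[OF K(3)[OF fK] fK] .
  have ip_h: "ip h (S f) = ip h h + \<mu> * ip h f"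
    using ip_lin'[of h 1 "S f" "- \<mu>" f] unfolding h_def[symmetric] by simp
  define C where "C = \<mu> * ip h h - ip h (S h)"
  have ineq: "2 * t * ip h h \<le> t\<^sup>2 * C" for t
  proof -
    have "ip (\<lambda>v. 1 * f v + t * h v) (S (\<lambda>v. 1 * f v + t * h v))
        \<le> \<mu> * ip (\<lambda>v. 1 * f v + t * h v) (\<lambda>v. 1 * f v + t * h v)"
      by (intro Q K(2) fK hK)
    then have "\<mu> + t * ip f (S h) + t * ip h (S f) + t * t * ip h (S h)
        \<le> \<mu> * (1 + t * ip f h + t * ip h f + t * t * ip h h)"
      unfolding lin ip_lin ip_lin' by (simp add: f1 \<mu>_def[symmetric] algebra_simps)
    moreover have "ip f (S h) = ip h (S f)" "ip f h = ip h f"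
      using ip_S ip_comm by metis+
    ultimately show ?thesis
      using ip_h by (simp add: C_def algebra_simps power2_eq_square)
  qed
  have "ip h h = 0"
    using ineq ip_ge by (rule linear_le_quadratic_imp_zero)
  then have "S f v = \<mu> * f v" if "v \<in> V" for v
    using ip_0[OF _ that, of h] by (simp add: h_def)
  moreover have "\<exists>v\<in>V. f v \<noteq> 0"
  proof (rule ccontr)
    assume "\<not> ?thesis"
    then have "ip f f = 0"
      unfolding ip_def by (intro sum.neutral) auto
    then show False
      using f1 by simp
  qed
  ultimately show thesis
    using fK that by blast
qed

section \<open>Unobservable functions and their eigenvectors\<close>

context connected_graph
begin

text \<open>This is \<open>M\<^sup>-\<^sup>1 L\<close> for one scalar component, with masses
  \<open>m\<close>. It is self-adjoint for the inner product weighted by \<open>m\<close>.\<close>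

definition stiffness :: "('v set \<Rightarrow> real) \<Rightarrow> ('v \<Rightarrow> real) \<Rightarrow> ('v \<Rightarrow> real) \<Rightarrow> 'v \<Rightarrow> real" where
  "stiffness w m f v = laplacian w f v / m v"

lemma laplacian_outside: "v \<notin> pverts G \<Longrightarrow> laplacian w f v = 0"
  unfolding laplacian_def by (intro sum.neutral) (auto dest: neighborD)

lemma laplacian_cong:
  "(\<And>u. u \<in> pverts G \<Longrightarrow> f u = g u) \<Longrightarrow> v \<in> pverts G \<Longrightarrow> laplacian w f v = laplacian w g v"
  unfolding laplacian_def by (intro sum.cong) (auto dest: neighborD)

lemma stiffness_pow_cong:
  assumes "\<And>u. u \<in> pverts G \<Longrightarrow> f u = g u" "v \<in> pverts G"
  shows "(stiffness w m ^^ k) f v = (stiffness w m ^^ k) g v"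
  using assms(2)
proof (induction k arbitrary: v)
  case (Suc k)
  then show ?case
    using laplacian_cong[of "(stiffness w m ^^ k) f" "(stiffness w m ^^ k) g"]
    by (simp add: stiffness_def[of w m "(stiffness w m ^^ k) _"])
qed (use assms in simp)

text \<open>The diagonal terms agree on both sides. The others are a sum over ordered adjacent
  pairs, in which the two endpoints can be exchanged.\<close>

lemma laplacian_symmetric:
  "(\<Sum>v\<in>pverts G. f v * laplacian w g v) = (\<Sum>v\<in>pverts G. laplacian w f v * g v)"
proof -
  have swap: "(\<Sum>v\<in>pverts G. \<Sum>u\<in>neighbors G v. h v u) = (\<Sum>v\<in>pverts G. \<Sum>u\<in>neighbors G v. h u v)"
    for h :: "'v \<Rightarrow> 'v \<Rightarrow> real"
  proof -
    have "(\<Sum>v\<in>pverts G. \<Sum>u\<in>neighbors G v. h v u)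
        = (\<Sum>v\<in>pverts G. \<Sum>u\<in>{u \<in> pverts G. u \<in> neighbors G v}. h v u)"
      by (intro sum.cong) (auto dest: neighborD)
    also have "\<dots> = (\<Sum>u\<in>pverts G. \<Sum>v\<in>{v \<in> pverts G. u \<in> neighbors G v}. h v u)"
      by (rule sum.swap_restrict) (rule pair_finite_verts)+
    also have "\<dots> = (\<Sum>u\<in>pverts G. \<Sum>v\<in>neighbors G u. h v u)"
      by (intro sum.cong) (auto dest: neighborD)
    finally show ?thesis .
  qed
  have "(\<Sum>v\<in>pverts G. f v * laplacian w g v) - (\<Sum>v\<in>pverts G. laplacian w f v * g v)
      = (\<Sum>v\<in>pverts G. \<Sum>u\<in>neighbors G v. w {v, u} * (f u * g v))
        - (\<Sum>v\<in>pverts G. \<Sum>u\<in>neighbors G v. w {v, u} * (f v * g u))"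
    unfolding laplacian_def sum_distrib_left sum_distrib_right sum_subtractf[symmetric]
    by (intro sum.cong refl) (simp add: algebra_simps)
  also have "\<dots> = 0"
    by (subst swap) (simp add: insert_commute mult_ac)
  finally show ?thesis
    by simp
qed

text \<open>A Hautus-type observability test: functions whose iterates all vanish on the damped
  nodes form an invariant subspace. If it is nonzero it contains an eigenvector, and an eigenvector
  satisfies the hypotheses of the sign coloring.\<close>

lemma unobservable_richly_balanced:
  assumes w: "\<And>e. e \<in> edges G \<Longrightarrow> w e > 0" and m: "\<And>v. v \<in> pverts G \<Longrightarrow> m v > 0"
    and nz: "\<exists>v\<in>pverts G. f v \<noteq> 0"
    and unobs: "\<And>k v. v \<in> Vd \<Longrightarrow> (stiffness w m ^^ k) f v = 0"
  shows "\<exists>c. coloring Vd c \<and> richly_balanced G c"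
proof -
  define S where "S = stiffness w m"
  \<comment> \<open>Support in \<open>pverts G\<close> is demanded because functions live on the
    whole type. Truncating \<open>f\<close> accordingly does not change its iterates on the
    nodes.\<close>
  define K where "K = {f. (\<forall>v. v \<notin> pverts G \<longrightarrow> f v = 0) \<and> (\<forall>k v. v \<in> Vd \<longrightarrow> (S ^^ k) f v = 0)}"
  have lin: "S (\<lambda>v. a * f v + b * g v) = (\<lambda>v. a * S f v + b * S g v)" for a b f g
    unfolding S_def stiffness_def laplacian_def
    by (simp add: fun_eq_iff algebra_simps sum.distrib sum_subtractf sum_distrib_left
        add_divide_distrib diff_divide_distrib sum_divide_distrib)
  have lin_pow: "(S ^^ k) (\<lambda>v. a * f v + b * g v) = (\<lambda>v. a * (S ^^ k) f v + b * (S ^^ k) g v)" for k a b f g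
    by (induction k) (simp_all add: lin)
  have coord: "continuous_on UNIV (\<lambda>f. F f v)" if "continuous_on UNIV F"
    for F :: "('v \<Rightarrow> real) \<Rightarrow> 'v \<Rightarrow> real" and v
    using that by (rule continuous_on_product_then_coordinatewise)
  have cont: "continuous_on UNIV S"
    unfolding S_def stiffness_def laplacian_def divide_inverse
    by (intro continuous_on_coordinatewise_then_product continuous_intros continuous_on_product_coordinates)
  have cont_pow: "continuous_on UNIV (S ^^ k)" for k
  proof (induction k)
    case 0
    show ?case
      by (simp add: id_def)
  next
    case (Suc k)
    then show ?case
      using continuous_on_compose[OF Suc] continuous_on_subset[OF cont] by auto
  qed
  have K_closed: "closed K"
    unfolding K_def by (intro closed_Collect_conj closed_Collect_all closed_Collect_imp closed_Collect_eq
        coord cont_pow continuous_on_id continuous_on_const open_Collect_const)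
  have K_inv: "S f \<in> K" if "f \<in> K" for f
  proof -
    have "(S ^^ k) (S f) v = 0" if "v \<in> Vd" for k v
    proof -
      have "\<forall>j. (S ^^ j) f v = 0"
        using \<open>f \<in> K\<close> that by (simp add: K_def)
      then show ?thesis
        unfolding funpow_swap1[symmetric] by (metis funpow.simps(2) comp_apply)
    qed
    moreover have "S f v = 0" if "v \<notin> pverts G" for v
      using that by (simp add: S_def stiffness_def laplacian_outside)
    ultimately show ?thesis
      by (simp add: K_def)
  qed
  have u: "(\<lambda>v. if v \<in> pverts G then f v else 0) \<in> K"
    using unobs damped stiffness_pow_cong[of "\<lambda>v. if v \<in> pverts G then f v else 0" f _ _ w m]
    by (auto simp: K_def S_def)
  have sym: "(\<Sum>v\<in>pverts G. m v * f v * S g v) = (\<Sum>v\<in>pverts G. m v * S f v * g v)" for f g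
  proof -
    have "(\<Sum>v\<in>pverts G. m v * f v * S g v) = (\<Sum>v\<in>pverts G. f v * laplacian w g v)"
      "(\<Sum>v\<in>pverts G. m v * S f v * g v) = (\<Sum>v\<in>pverts G. laplacian w f v * g v)"
      using m by (auto intro!: sum.cong simp: S_def stiffness_def less_imp_neq[symmetric])
    then show ?thesis
      using laplacian_symmetric by metis
  qed
  have u_nz: "\<exists>v\<in>pverts G. (if v \<in> pverts G then f v else 0) \<noteq> 0"
    using nz by auto
  have K_lin: "(\<lambda>v. a * f v + b * g v) \<in> K" if "f \<in> K" "g \<in> K" for a b f g
    using that by (auto simp: K_def lin_pow)
  have K_supp: "\<forall>v. v \<notin> pverts G \<longrightarrow> f v = 0" if "f \<in> K" for f
    using that by (simp add: K_def)
  obtain g \<mu> where g: "g \<in> K" "\<exists>v\<in>pverts G. g v \<noteq> 0" "\<And>v. v \<in> pverts G \<Longrightarrow> S g v = \<mu> * g v"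
    using self_adjoint_eigenvector[where V = "pverts G" and m = m and S = S and K = K
        and u = "\<lambda>v. if v \<in> pverts G then f v else 0", OF pair_finite_verts m
        lin cont sym K_closed K_lin K_inv K_supp u u_nz]
    by metis
  have lap0: "laplacian w g v = 0" if "v \<in> pverts G" "g v = 0" for v
    using g(3)[OF that(1)] m[OF that(1)] that(2) by (simp add: S_def stiffness_def)
  have damp0: "g v = 0" if "v \<in> Vd" for v
    using g(1) that unfolding K_def by (auto dest: spec[of _ 0])
  show ?thesis
    by (rule sign_coloring_richly_balanced[where w = w and f = g]) (fact w g(2) damp0 lap0)+
qed

end

section \<open>Matrices and incidence operators\<close>

lemma diagonal_matrix_mult_nth:
  assumes "diagonal_matrix D"
  shows "(D *v x) $ i = D $ i $ i * x $ i"
proof -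
  have "(D *v x) $ i = (\<Sum>j\<in>UNIV. D $ i $ j * x $ j)"
    by (simp add: matrix_vector_mult_def)
  also have "\<dots> = (\<Sum>j\<in>UNIV. if j = i then D $ i $ i * x $ i else 0)"
    using assms by (intro sum.cong) (auto simp: diagonal_matrix_def)
  finally show ?thesis
    by simp
qed

lemma sym_pos_def_diagonal_pos:
  assumes "sym_pos_def D" "diagonal_matrix D"
  shows "D $ i $ i > 0"
proof -
  have "axis i (1::real) \<bullet> (D *v axis i 1) > 0"
    using assms(1) by (simp add: sym_pos_def_def)
  then show ?thesis
    by (simp add: inner_axis' diagonal_matrix_mult_nth[OF assms(2)])
qed

lemma matrix_inv_diagonal_nth:
  assumes D: "diagonal_matrix D" and pos: "\<And>i. D $ i $ i > 0"
  shows "(matrix_inv D *v x) $ i = x $ i / D $ i $ i"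
proof -
  have "\<forall>x. D *v x = 0 \<longrightarrow> x = 0"
    using pos by (auto simp: vec_eq_iff diagonal_matrix_mult_nth[OF D]) (metis less_irrefl)
  then have "invertible D"
    by (simp add: invertible_left_inverse matrix_left_invertible_ker)
  then have "D ** matrix_inv D = mat 1"
    unfolding invertible_def matrix_inv_def by (metis (mono_tags, lifting) someI_ex)
  then have "D *v (matrix_inv D *v x) = x"
    by (simp add: matrix_vector_mul_assoc)
  then have "D $ i $ i * (matrix_inv D *v x) $ i = x $ i"
    using diagonal_matrix_mult_nth[OF D] by metis
  then show ?thesis
    using pos[of i] by (simp add: field_simps)
qed

text \<open>The quadratic form has a minimum at \<open>x\<close>. Moving from \<open>x\<close> in
  the direction \<open>- (A *v x)\<close> would decrease it to first order unless
  \<open>A *v x = 0\<close>.\<close>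

lemma sym_pos_semidef_null:
  assumes A: "sym_pos_semidef A" and x: "x \<bullet> (A *v x) = 0"
  shows "A *v x = 0"
proof -
  define y where "y = A *v x"
  have comm: "x \<bullet> (A *v z) = y \<bullet> z" for z
    using A by (metis dot_lmul_matrix sym_pos_semidef_def transpose_matrix_vector y_def)
  have "2 * t * (y \<bullet> y) \<le> t\<^sup>2 * (y \<bullet> (A *v y))" for t
  proof -
    have "0 \<le> (x - t *\<^sub>R y) \<bullet> (A *v (x - t *\<^sub>R y))"
      using A by (simp add: sym_pos_semidef_def)
    also have "\<dots> = - (2 * t * (y \<bullet> y)) + t\<^sup>2 * (y \<bullet> (A *v y))"
      using x comm[of y]
      by (simp add: y_def[symmetric] power2_eq_square algebra_simps)
    finally show ?thesis
      by simp
  qed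
  then have "y \<bullet> y = 0"
    by (rule linear_le_quadratic_imp_zero) simp
  then show ?thesis
    by (simp add: y_def)
qed

section \<open>The incidence operator and its image\<close>

locale incidence_graph = connected_graph G Vd
  for G :: "'v pair_pre_digraph" and Vd +
  fixes B :: "'v \<Rightarrow> 'v set \<Rightarrow> real"
  assumes incidence: "oriented_incidence_matrix G B"
begin

lemma incidence_neighbor:
  assumes "u \<in> neighbors G v"
  shows "B v {v, u} = 1 \<or> B v {v, u} = -1" "B u {v, u} = - B v {v, u}"
    "x \<in> pverts G \<Longrightarrow> x \<noteq> v \<Longrightarrow> x \<noteq> u \<Longrightarrow> B x {v, u} = 0"
proof -
  obtain a b where "{v, u} = {a, b}" "a \<noteq> b" "B a {v, u} = 1" "B b {v, u} = -1"
      "\<forall>w\<in>pverts G - {a, b}. B w {v, u} = 0"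
    using incidence neighborD(5)[OF assms] unfolding oriented_incidence_matrix_def by blast
  then show "B v {v, u} = 1 \<or> B v {v, u} = -1" "B u {v, u} = - B v {v, u}"
    "x \<in> pverts G \<Longrightarrow> x \<noteq> v \<Longrightarrow> x \<noteq> u \<Longrightarrow> B x {v, u} = 0"
    by (auto simp: doubleton_eq_iff)
qed

lemma edge_neighborE:
  assumes "e \<in> edges G"
  obtains v u where "e = {v, u}" "u \<in> neighbors G v"
  using assms by (auto simp: edges_def neighbors_def)

lemma kron_inc_transpose_edge:
  assumes u: "u \<in> neighbors G v"
  shows "kron_inc_transpose G B f {v, u} = B v {v, u} *\<^sub>R (f v - f u)"
proof -
  have "kron_inc_transpose G B f {v, u} = (\<Sum>x\<in>{v, u}. B x {v, u} *\<^sub>R f x)"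
    unfolding kron_inc_transpose_def
    using neighborD[OF u] incidence_neighbor(3)[OF u] by (intro sum.mono_neutral_right pair_finite_verts) auto
  then show ?thesis
    using neighborD(3)[OF u] incidence_neighbor(2)[OF u] by (simp add: scaleR_diff_right)
qed

text \<open>The sign \<open>B v {v, u}\<close> enters once from each incidence operator and squares
  to \<open>1\<close>, so the orientation disappears and the vector-valued Laplacian
  remains.\<close>

lemma kron_inc_weighted:
  fixes f :: "'v \<Rightarrow> real ^ 'r"
  assumes v: "v \<in> pverts G"
  shows "kron_inc G B (\<lambda>e. W e *v kron_inc_transpose G B f e) v
    = (\<Sum>u\<in>neighbors G v. W {v, u} *v (f v - f u))"
proof -
  let ?y = "\<lambda>e. W e *v kron_inc_transpose G B f e"
  have "B v e = 0" if "e \<in> edges G" "e \<notin> (\<lambda>u. {v, u}) ` neighbors G v" for e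
  proof -
    obtain a b where ab: "e = {a, b}" "b \<in> neighbors G a"
      using edge_neighborE[OF \<open>e \<in> edges G\<close>] .
    then have "v \<noteq> a" "v \<noteq> b"
      using that neighborD(4)[of b a] by (auto simp: insert_commute)
    then show ?thesis
      using ab incidence_neighbor(3) v by blast
  qed
  then have "kron_inc G B ?y v = (\<Sum>e\<in>(\<lambda>u. {v, u}) ` neighbors G v. B v e *\<^sub>R ?y e)"
    unfolding kron_inc_def using neighborD(5) by (intro sum.mono_neutral_right finite_edges) auto
  also have "\<dots> = (\<Sum>u\<in>neighbors G v. B v {v, u} *\<^sub>R ?y {v, u})"
    by (subst sum.reindex) (auto simp: inj_on_def doubleton_eq_iff)
  also have "\<dots> = (\<Sum>u\<in>neighbors G v. W {v, u} *v (f v - f u))"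
  proof (rule sum.cong[OF refl])
    fix u assume u: "u \<in> neighbors G v"
    then show "B v {v, u} *\<^sub>R ?y {v, u} = W {v, u} *v (f v - f u)"
      using incidence_neighbor(1)[OF u]
      by (auto simp: kron_inc_transpose_edge matrix_vector_mult_scaleR matrix_vector_mult_diff_distrib)
  qed
  finally show ?thesis .
qed

lemma kron_inc_adjoint:
  "(\<Sum>v\<in>pverts G. x v \<bullet> kron_inc G B y v) = (\<Sum>e\<in>edges G. kron_inc_transpose G B x e \<bullet> y e)"
  unfolding kron_inc_def kron_inc_transpose_def inner_sum_right inner_sum_left
  by (subst sum.swap) simp

text \<open>Summing differences along a path from \<open>v\<^sub>0\<close> to \<open>v\<close> inverts the transposed incidence
  operator up to a constant; hence \<open>Omega\<close> is cut out by finitely many linear equations.\<close>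

lemma kron_inc_transpose_left_inverse:
  assumes v0: "v0 \<in> pverts G"
  obtains c :: "'v \<Rightarrow> 'v set \<Rightarrow> real" where
    "\<And>(f :: 'v \<Rightarrow> real ^ 'r) v. v \<in> pverts G \<Longrightarrow>
      (\<Sum>e\<in>edges G. c v e *\<^sub>R kron_inc_transpose G B f e) = f v - f v0"
proof -
  have "\<exists>c. \<forall>f :: 'v \<Rightarrow> real ^ 'r. (\<Sum>e\<in>edges G. c e *\<^sub>R kron_inc_transpose G B f e) = f v - f v0"
    if "v \<in> pverts G" for v
    using parcs_rtrancl[OF v0 that]
  proof induction
    case base
    show ?case
      by (intro exI[of _ "\<lambda>_. 0"]) simp
  next
    case (step a b)
    obtain c where c: "\<And>f :: 'v \<Rightarrow> real ^ 'r. (\<Sum>e\<in>edges G. c e *\<^sub>R kron_inc_transpose G B f e) = f a - f v0"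
      using step by blast
    have ab: "b \<in> neighbors G a"
      using step by (simp add: neighbors_def)
    \<comment> \<open>Appends the arc from \<open>a\<close> to \<open>b\<close> to the path; the
      sign \<open>B a {a, b}\<close> turns the edge value into \<open>f a - f b\<close>.\<close>
    define c' where "c' e = c e + (if e = {a, b} then - B a {a, b} else 0)" for e
    have "(\<Sum>e\<in>edges G. c' e *\<^sub>R kron_inc_transpose G B f e) = f b - f v0" for f :: "'v \<Rightarrow> real ^ 'r"
    proof -
      have "(\<Sum>e\<in>edges G. c' e *\<^sub>R kron_inc_transpose G B f e)
          = (\<Sum>e\<in>edges G. c e *\<^sub>R kron_inc_transpose G B f e)
            + (\<Sum>e\<in>edges G. if e = {a, b} then - B a {a, b} *\<^sub>R kron_inc_transpose G B f {a, b} else 0)"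
        unfolding sum.distrib[symmetric] c'_def by (intro sum.cong) (auto simp: scaleR_add_left)
      also have "\<dots> = f a - f v0 - B a {a, b} *\<^sub>R kron_inc_transpose G B f {a, b}"
        unfolding c using neighborD(5)[OF ab] by (simp add: finite_edges)
      also have "\<dots> = f b - f v0"
        unfolding kron_inc_transpose_edge[OF ab] using incidence_neighbor(1)[OF ab] by auto
      finally show ?thesis .
    qed
    then show ?case
      by blast
  qed
  then obtain c where "\<And>v. v \<in> pverts G \<Longrightarrow>
      \<forall>f :: 'v \<Rightarrow> real ^ 'r. (\<Sum>e\<in>edges G. c v e *\<^sub>R kron_inc_transpose G B f e) = f v - f v0"
    by metis
  then show thesis
    by (intro that[of c]) blast
qed

text \<open>The potential recovered from \<open>q\<close> is correct up to its value at
  \<open>v0\<close>, a constant that the transposed incidence operator annihilates. Membership thus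
  becomes a fixed linear equation in \<open>q\<close>, which can be differentiated and passed to
  limits.\<close>

lemma Omega_equations:
  obtains c :: "'v \<Rightarrow> 'v set \<Rightarrow> real" where
    "\<forall>q :: 'v set \<Rightarrow> real ^ 'r. (\<exists>x. \<forall>e\<in>edges G. q e = kron_inc_transpose G B x e) \<longleftrightarrow>
      (\<forall>e\<in>edges G. q e = kron_inc_transpose G B (\<lambda>v. \<Sum>e\<in>edges G. c v e *\<^sub>R q e) e)"
proof -
  obtain v0 where v0: "v0 \<in> pverts G"
    using damped by blast
  obtain c :: "'v \<Rightarrow> 'v set \<Rightarrow> real" where c: "\<And>(f :: 'v \<Rightarrow> real ^ 'r) v. v \<in> pverts G \<Longrightarrow>
      (\<Sum>e\<in>edges G. c v e *\<^sub>R kron_inc_transpose G B f e) = f v - f v0"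
    using kron_inc_transpose_left_inverse[OF v0] by blast
  have "q e = kron_inc_transpose G B (\<lambda>v. \<Sum>e\<in>edges G. c v e *\<^sub>R q e) e"
    if q: "\<forall>e\<in>edges G. q e = kron_inc_transpose G B x e" and e: "e \<in> edges G" for x e and q :: "'v set \<Rightarrow> real ^ 'r"
  proof -
    have "(\<Sum>e\<in>edges G. c v e *\<^sub>R q e) = x v - x v0" if "v \<in> pverts G" for v
      unfolding c[OF that, symmetric] using q by (intro sum.cong) auto
    then have "kron_inc_transpose G B (\<lambda>v. \<Sum>e\<in>edges G. c v e *\<^sub>R q e) e = kron_inc_transpose G B (\<lambda>v. x v - x v0) e"
      unfolding kron_inc_transpose_def by (intro sum.cong) auto
    also have "\<dots> = kron_inc_transpose G B x e"
      using e by (elim edge_neighborE) (simp add: kron_inc_transpose_edge)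
    finally show ?thesis
      using q e by simp
  qed
  then show thesis
    by (intro that[of c]) blast
qed

section \<open>Undamped oscillations from richly balanced colorings\<close>

lemma not_PI_GAS_if_richly_balanced:
  assumes col: "coloring Vd c" and rich: "richly_balanced G c"
  shows "\<not> PI_GAS TYPE('r::finite) G Vd B"
proof
  assume gas: "PI_GAS TYPE('r) G Vd B"
  obtain w m f where ex: "\<forall>e\<in>edges G. w e > 0" "\<forall>v\<in>pverts G. m v > 0"
    "\<forall>v\<in>pverts G. laplacian w f v = m v * f v" "\<forall>v\<in>Vd. f v = 0" and nz: "\<exists>v\<in>pverts G. f v \<noteq> 0"
    using richly_balanced_eigenvector[OF col rich] by (elim exE conjE) (rule that)
  have w: "w e > 0" if "e \<in> edges G" for e
    using ex that by blast
  have m: "m v > 0" and lap: "laplacian w f v = m v * f v" if "v \<in> pverts G" for v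
    using ex that by blast+
  have damped0: "f v = 0" if "v \<in> Vd" for v
    using ex that by blast
  define M :: "'v \<Rightarrow> real ^ 'r ^ 'r" where "M v = mat (m v)" for v
  define W :: "'v set \<Rightarrow> real ^ 'r ^ 'r" where "W e = mat (w e)" for e
  \<comment> \<open>Zero blocks are semidefinite and singular, hence feasible at undamped nodes. At
    damped nodes the oscillation has zero velocity, so \<open>R\<close> never acts on it.\<close>
  define R :: "'v \<Rightarrow> real ^ 'r ^ 'r" where "R v = (if v \<in> Vd then mat 1 else 0)" for v
  have diag: "diagonal_matrix (mat k :: real ^ 'r ^ 'r)" for k
    by (simp add: diagonal_matrix_def mat_def)
  have mat_nth: "(mat k :: real ^ 'r ^ 'r) $ i $ i = k" for k i
    by (simp add: mat_def)
  have mat_mult: "mat k *v x = k *\<^sub>R x" for k :: real and x :: "real ^ 'r"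
    by (simp add: vec_eq_iff diagonal_matrix_mult_nth[OF diag] mat_nth)
  have pos: "sym_pos_def (mat k :: real ^ 'r ^ 'r)" if "k > 0" for k
    using that by (simp add: sym_pos_def_def transpose_mat mat_mult)
  have zero: "sym_pos_semidef (0 :: real ^ 'r ^ 'r)" "\<not> invertible (0 :: real ^ 'r ^ 'r)"
  proof -
    show "sym_pos_semidef (0 :: real ^ 'r ^ 'r)"
      by (simp add: sym_pos_semidef_def transpose_def vec_eq_iff)
    show "\<not> invertible (0 :: real ^ 'r ^ 'r)"
      using det_0[where 'a = real and 'n = 'r] by (simp add: invertible_det_nz mat_def zero_vec_def if_distrib cong: if_cong)
  qed
  have feas: "feasible G Vd M W R"
    unfolding feasible_def M_def W_def R_def using w m by (simp add: diag pos zero)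
  define X :: "'v \<Rightarrow> real ^ 'r" where "X v = f v *\<^sub>R 1" for v
  define z where "z t = (\<lambda>v. cos t *\<^sub>R (m v *\<^sub>R X v), \<lambda>e. sin t *\<^sub>R kron_inc_transpose G B X e)" for t :: real
  have inv_M: "matrix_inv (M v) *v x = (1 / m v) *\<^sub>R x" if "v \<in> pverts G" for v x
    using m[OF that] by (simp add: vec_eq_iff M_def matrix_inv_diagonal_nth[OF diag] mat_nth)
  have vel: "block_diag_mult (block_diag_inv M) (fst (z t)) v = cos t *\<^sub>R X v" if "v \<in> pverts G" for t v
    using m[OF that] by (simp add: block_diag_mult_def block_diag_inv_def z_def inv_M[OF that])
  have R: "block_diag_mult R (block_diag_mult (block_diag_inv M) (fst (z t))) v = 0" if "v \<in> pverts G" for t v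
    using vel[OF that, of t] damped0 by (auto simp: block_diag_mult_def[of R] R_def X_def)
  have L: "kron_inc G B (block_diag_mult W (snd (z t))) v = sin t *\<^sub>R (m v *\<^sub>R X v)" if v: "v \<in> pverts G" for t v
  proof -
    have "kron_inc G B (block_diag_mult W (snd (z t))) v
        = kron_inc G B (\<lambda>e. (sin t *\<^sub>R W e) *v kron_inc_transpose G B X e) v"
      by (simp add: block_diag_mult_def z_def matrix_vector_mult_scaleR scaleR_matrix_vector_assoc)
    also have "\<dots> = (sin t * laplacian w f v) *\<^sub>R 1"
      unfolding kron_inc_weighted[OF v]
      by (simp add: laplacian_def W_def mat_mult X_def scaleR_sum_left sum_distrib_left scaleR_diff_left
          scaleR_matrix_vector_assoc[symmetric] right_diff_distrib scaleR_diff_right)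
    finally show ?thesis
      by (simp add: lap[OF v] X_def)
  qed
  have T: "kron_inc_transpose G B (block_diag_mult (block_diag_inv M) (fst (z t))) e
      = cos t *\<^sub>R kron_inc_transpose G B X e" for t e
    unfolding kron_inc_transpose_def scaleR_sum_right by (intro sum.cong) (simp_all add: vel)
  have "is_solution G B M W R z"
    unfolding is_solution_def
  proof (intro allI impI conjI ballI)
    fix t :: real and v assume v: "v \<in> pverts G"
    have "((\<lambda>s. cos s *\<^sub>R (m v *\<^sub>R X v)) has_vector_derivative (- sin t) *\<^sub>R (m v *\<^sub>R X v)) (at t within {0..})"
      by (auto intro!: derivative_eq_intros simp: has_real_derivative_iff_has_vector_derivative[symmetric])
    then show "((\<lambda>s. fst (z s) v) has_vector_derivative
        - block_diag_mult R (block_diag_mult (block_diag_inv M) (fst (z t))) v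
        - kron_inc G B (block_diag_mult W (snd (z t))) v) (at t within {0..})"
      unfolding R[OF v] L[OF v] by (simp add: z_def)
  next
    fix t :: real and e
    have "((\<lambda>s. sin s *\<^sub>R kron_inc_transpose G B X e) has_vector_derivative cos t *\<^sub>R kron_inc_transpose G B X e)
        (at t within {0..})"
      by (auto intro!: derivative_eq_intros simp: has_real_derivative_iff_has_vector_derivative[symmetric])
    then show "((\<lambda>s. snd (z s) e) has_vector_derivative
        kron_inc_transpose G B (block_diag_mult (block_diag_inv M) (fst (z t))) e) (at t within {0..})"
      unfolding T by (simp add: z_def)
  qed
  moreover have "z 0 \<in> Omega G B"
    unfolding Omega_def z_def by (auto intro!: exI[of _ "\<lambda>_. 0"] simp: kron_inc_transpose_def)
  ultimately have lim: "((\<lambda>t. state_norm G (z t)) \<longlongrightarrow> 0) at_top"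
    using gas feas unfolding PI_GAS_def origin_GAS_def by blast
  \<comment> \<open>The oscillation has period \<open>2 * pi\<close>: sampling it at multiples of
    the period gives a constant sequence, which cannot tend to \<open>0\<close> unless the initial
    state vanishes.\<close>
  have "filterlim (\<lambda>n. 2 * pi * real n) at_top sequentially"
    by (rule filterlim_tendsto_pos_mult_at_top[OF tendsto_const _ filterlim_real_sequentially]) simp
  from filterlim_compose[OF lim this]
  have "(\<lambda>n. state_norm G (z (2 * pi * real n))) \<longlonglongrightarrow> 0" .
  moreover have "state_norm G (z (2 * pi * real n)) = state_norm G (z 0)" for n
  proof -
    have "cos (2 * pi * real n) = 1" "sin (2 * pi * real n) = 0"
      using cos_npi[of "2 * n"] sin_npi[of "2 * n"] by (simp_all add: mult_ac)
    then show ?thesis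
      by (simp add: z_def)
  qed
  ultimately have "state_norm G (z 0) = 0"
    by (simp add: LIMSEQ_const_iff)
  then have "(\<Sum>v\<in>pverts G. (norm (m v *\<^sub>R X v))\<^sup>2) = 0"
    by (simp add: state_norm_def z_def)
  then have "\<forall>v\<in>pverts G. m v *\<^sub>R X v = 0"
    by (subst (asm) sum_nonneg_eq_0_iff) (simp_all add: pair_finite_verts)
  then show False
    using nz m by (force simp: X_def)
qed

end

section \<open>Real analysis\<close>

text \<open>The mean value theorem for derivatives within \<open>{0..}\<close>, the form in which
  solutions provide them.\<close>

lemma mvt_half_line:
  fixes f f' :: "real \<Rightarrow> real"
  assumes "0 \<le> a" "a \<le> b" "\<And>t. t \<ge> 0 \<Longrightarrow> (f has_real_derivative f' t) (at t within {0..})"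
  shows "\<exists>s\<in>{a..b}. f b - f a = f' s * (b - a)"
proof (rule mvt_very_simple[OF assms(2)])
  fix s assume "a \<le> s" "s \<le> b"
  then have "(f has_derivative (*) (f' s)) (at s within {0..})"
    using assms(3)[of s] assms(1) by (simp add: has_field_derivative_def)
  then show "(f has_derivative (*) (f' s)) (at s within {a..b})"
    by (rule has_derivative_subset) (use assms(1) in auto)
qed

text \<open>Barbalat's argument: the loss of \<open>H\<close> over a window of length \<open>h\<close> tends to \<open>0\<close>, while \<open>g\<close>
  varies by at most \<open>L * h\<close> on that window.\<close>

lemma nonneg_dissipation_tendsto_0:
  fixes H g g' :: "real \<Rightarrow> real"
  assumes H: "\<And>t. t \<ge> 0 \<Longrightarrow> (H has_real_derivative - g t) (at t within {0..})" "\<And>t. t \<ge> 0 \<Longrightarrow> H t \<ge> 0"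
    and g: "\<And>t. t \<ge> 0 \<Longrightarrow> g t \<ge> 0" "\<And>t. t \<ge> 0 \<Longrightarrow> (g has_real_derivative g' t) (at t within {0..})"
    and L: "\<And>t. t \<ge> 0 \<Longrightarrow> \<bar>g' t\<bar> \<le> L"
  shows "(g \<longlongrightarrow> 0) at_top"
proof -
  have anti: "H t \<le> H s" if st: "0 \<le> s" "s \<le> t" for s t
  proof -
    obtain r where r: "r \<in> {s..t}" "H t - H s = - g r * (t - s)"
      using mvt_half_line[OF st, of H "\<lambda>t. - g t"] H(1) by blast
    moreover have "g r * (t - s) \<ge> 0"
      using r st by (intro mult_nonneg_nonneg g(1)) auto
    ultimately show ?thesis
      by simp
  qed
  define l where "l = Inf (H ` {0..})"
  have bdd: "bdd_below (H ` {0..})"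
    using H(2) by (intro bdd_belowI2[of _ 0]) simp
  have l: "l \<le> H t" if "t \<ge> 0" for t
    unfolding l_def using that by (intro cInf_lower bdd) simp
  have L0: "L \<ge> 0"
    using L[of 0] by simp
  show ?thesis
  proof (rule tendstoI)
    fix e :: real assume e: "e > 0"
    \<comment> \<open>The window is so short that \<open>g\<close> varies on it by at most
      \<open>e / 2\<close>. Past \<open>T\<close>, where \<open>H\<close> is within
      \<open>e * h / 2\<close> of its infimum, every window contains a point with
      \<open>g s < e / 2\<close>.\<close>
    define h where "h = e / (2 * (L + 1))"
    have h: "h > 0" "L * h \<le> e / 2"
      using e L0 by (auto simp: h_def field_simps)
    have "l < l + e * h / 2"
      using e h by simp
    then obtain T where T: "T \<ge> 0" "H T < l + e * h / 2"
      using cInf_lessD[of "H ` {0..}" "l + e * h / 2"] by (auto simp: l_def)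
    have "dist (g t) 0 < e" if t: "t \<ge> T" for t
    proof -
      have t0: "t \<ge> 0"
        using t T by simp
      obtain s where s: "s \<in> {t..t + h}" "H (t + h) - H t = - g s * (t + h - t)"
        using mvt_half_line[OF t0, of "t + h" H "\<lambda>t. - g t"] H(1) h by auto
      have "H t - H (t + h) < e * h / 2"
        using anti[OF T(1) t] l[of "t + h"] t0 h T by linarith
      then have "g s * h < e / 2 * h"
        using s by simp
      then have gs: "g s < e / 2"
        using h by (simp only: mult_less_cancel_right_pos)
      obtain r where r: "r \<in> {t..s}" "g s - g t = g' r * (s - t)"
        using mvt_half_line[OF t0, of s g g'] g(2) s by auto
      have "\<bar>g' r * (s - t)\<bar> \<le> L * h"
        unfolding abs_mult using r s t0 L[of r] L0 by (intro mult_mono) auto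
      then have "g t \<le> g s + e / 2"
        using r h by linarith
      then show ?thesis
        using gs g(1)[OF t0] by simp
    qed
    then show "\<forall>\<^sub>F t in at_top. dist (g t) 0 < e"
      unfolding eventually_at_top_linorder by blast
  qed
qed

text \<open>Bolzano-Weierstrass in finitely many coordinates, with one subsequence for all of
  them.\<close>

lemma bounded_family_convergent_subseq:
  fixes f :: "nat \<Rightarrow> 'a \<Rightarrow> 'b :: heine_borel"
  assumes "finite A" "\<And>a. a \<in> A \<Longrightarrow> bounded (range (\<lambda>n. f n a))"
  obtains l r where "strict_mono (r :: nat \<Rightarrow> nat)" "\<And>a. a \<in> A \<Longrightarrow> (\<lambda>n. f (r n) a) \<longlonglongrightarrow> l a"
proof -
  have "\<forall>d\<subseteq>A. \<exists>l. \<exists>r::nat\<Rightarrow>nat. strict_mono r \<and>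
      (\<forall>\<epsilon>>0. eventually (\<lambda>n. \<forall>i\<in>d. dist (f (r n) i) (l i) < \<epsilon>) sequentially)"
    using assms by (intro compact_lemma_general[where unproj = "\<lambda>x. x"]) (auto simp: image_image)
  then obtain l and r :: "nat \<Rightarrow> nat" where r: "strict_mono r"
    and l: "\<forall>\<epsilon>>0. eventually (\<lambda>n. \<forall>i\<in>A. dist (f (r n) i) (l i) < \<epsilon>) sequentially"
    by blast
  have "(\<lambda>n. f (r n) a) \<longlonglongrightarrow> l a" if "a \<in> A" for a
  proof (rule tendstoI)
    fix e :: real assume "e > 0"
    with l have "\<forall>\<^sub>F n in sequentially. \<forall>i\<in>A. dist (f (r n) i) (l i) < e"
      by blast
    then show "\<forall>\<^sub>F n in sequentially. dist (f (r n) a) (l a) < e"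
      by (rule eventually_mono) (use that in blast)
  qed
  then show thesis
    using that r by blast
qed

lemma finite_positive_bounds:
  fixes f :: "'a \<Rightarrow> real"
  assumes "finite A" "\<And>a. a \<in> A \<Longrightarrow> f a > 0"
  obtains c C where "c > 0" "C > 0" "\<And>a. a \<in> A \<Longrightarrow> c \<le> f a \<and> f a \<le> C"
proof
  \<comment> \<open>Inserting \<open>1\<close> covers the empty family, which occurs for the edges
    of a one-node graph.\<close>
  show "Min (insert 1 (f ` A)) > 0" "Max (insert 1 (f ` A)) > 0"
    using assms by (auto simp: Max_gr_iff)
  show "Min (insert 1 (f ` A)) \<le> f a \<and> f a \<le> Max (insert 1 (f ` A))" if "a \<in> A" for a
    using assms that by (intro conjI Min_le Max_ge) auto
qed

section \<open>Asymptotic stability\<close>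

locale feasible_system = incidence_graph G Vd B
  for G :: "'v pair_pre_digraph" and Vd B +
  fixes M :: "'v \<Rightarrow> real ^ 'r :: finite ^ 'r" and W R
  assumes feasible: "feasible G Vd M W R"
begin

lemma M_diag: "v \<in> pverts G \<Longrightarrow> diagonal_matrix (M v)" and M_pos: "v \<in> pverts G \<Longrightarrow> M v $ i $ i > 0"
  using feasible sym_pos_def_diagonal_pos by (auto simp: feasible_def)

lemma W_diag: "e \<in> edges G \<Longrightarrow> diagonal_matrix (W e)" and W_pos: "e \<in> edges G \<Longrightarrow> W e $ i $ i > 0"
  using feasible sym_pos_def_diagonal_pos by (auto simp: feasible_def)

lemma R_semidef:
  assumes "v \<in> pverts G"
  shows "sym_pos_semidef (R v)"
proof (cases "v \<in> Vd")
  case True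
  then have R: "sym_pos_def (R v)"
    using feasible by (auto simp: feasible_def)
  have "x \<bullet> (R v *v x) \<ge> 0" for x
    using R by (cases "x = 0") (auto simp: sym_pos_def_def less_imp_le)
  then show ?thesis
    using R by (simp add: sym_pos_def_def sym_pos_semidef_def)
qed (use assms feasible in \<open>auto simp: feasible_def\<close>)

definition vel :: "('v \<Rightarrow> real ^ 'r) \<Rightarrow> 'v \<Rightarrow> real ^ 'r" where
  "vel p v = matrix_inv (M v) *v p v"

lemma block_diag_inv_mult: "block_diag_mult (block_diag_inv M) p = vel p"
  by (simp add: fun_eq_iff block_diag_mult_def block_diag_inv_def vel_def)

lemma vel_nth: "v \<in> pverts G \<Longrightarrow> vel p v $ i = p v $ i / M v $ i $ i"
  unfolding vel_def using M_diag M_pos by (intro matrix_inv_diagonal_nth)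

lemma vel_symmetric:
  assumes "v \<in> pverts G"
  shows "p v \<bullet> vel p' v = vel p v \<bullet> p' v"
  by (simp add: inner_vec_def vel_nth[OF assms])

lemma vel_eq_0_iff:
  assumes "v \<in> pverts G"
  shows "vel p v = 0 \<longleftrightarrow> p v = 0"
  using M_pos[OF assms] by (auto simp: vec_eq_iff vel_nth[OF assms]) (metis less_irrefl)+

text \<open>A map from states to states, so that it can be iterated: along a solution, the
  \<open>k\<close>-th iterate is the \<open>k\<close>-th time derivative.\<close>

definition vec_field :: "('v, 'r) state \<Rightarrow> ('v, 'r) state" where
  "vec_field z = (\<lambda>v. - (R v *v vel (fst z) v) - kron_inc G B (\<lambda>e. W e *v snd z e) v,
    kron_inc_transpose G B (vel (fst z)))"

lemma is_solution_iff:
  "is_solution G B M W R z \<longleftrightarrow> (\<forall>t\<ge>0.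
    (\<forall>v\<in>pverts G. ((\<lambda>s. fst (z s) v) has_vector_derivative fst (vec_field (z t)) v) (at t within {0..})) \<and>
    (\<forall>e\<in>edges G. ((\<lambda>s. snd (z s) e) has_vector_derivative snd (vec_field (z t)) e) (at t within {0..})))"
  unfolding is_solution_def block_diag_inv_mult by (simp add: vec_field_def block_diag_mult_def)

lemma solution_derivative:
  assumes "is_solution G B M W R z" "t \<ge> 0"
  shows "v \<in> pverts G \<Longrightarrow> ((\<lambda>s. fst (z s) v) has_vector_derivative fst (vec_field (z t)) v) (at t within {0..})"
    and "e \<in> edges G \<Longrightarrow> ((\<lambda>s. snd (z s) e) has_vector_derivative snd (vec_field (z t)) e) (at t within {0..})"
  using assms unfolding is_solution_iff by blast+

lemma vel_derivative:
  assumes "is_solution G B M W R z" "t \<ge> 0" "v \<in> pverts G"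
  shows "((\<lambda>s. vel (fst (z s)) v) has_vector_derivative vel (fst (vec_field (z t))) v) (at t within {0..})"
  unfolding vel_def
  by (rule bounded_linear.has_vector_derivative[OF matrix_vector_mul_bounded_linear solution_derivative(1)[OF assms]])

lemma kron_inc_transpose_derivative:
  assumes "\<And>v. v \<in> pverts G \<Longrightarrow> ((\<lambda>s. x s v) has_vector_derivative x' v) F"
  shows "((\<lambda>s. kron_inc_transpose G B (x s) e) has_vector_derivative kron_inc_transpose G B x' e) F"
  unfolding kron_inc_transpose_def
  by (intro has_vector_derivative_sum bounded_linear.has_vector_derivative[OF bounded_linear_scaleR_right] assms)

lemma kron_inc_derivative:
  assumes "\<And>e. e \<in> edges G \<Longrightarrow> ((\<lambda>s. y s e) has_vector_derivative y' e) F"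
  shows "((\<lambda>s. kron_inc G B (y s) v) has_vector_derivative kron_inc G B y' v) F"
  unfolding kron_inc_def
  by (intro has_vector_derivative_sum bounded_linear.has_vector_derivative[OF bounded_linear_scaleR_right] assms)

text \<open>The system is linear with constant coefficients, so the time derivative of a solution
  solves it again. Every estimate for solutions thereby extends to all time derivatives.\<close>

lemma is_solution_vec_field:
  assumes z: "is_solution G B M W R z"
  shows "is_solution G B M W R (\<lambda>t. vec_field (z t))"
proof -
  define y where "y t = vec_field (z t)" for t
  have y: "fst (y t) v = - (R v *v vel (fst (z t)) v) - kron_inc G B (\<lambda>e. W e *v snd (z t) e) v"
    "snd (y t) e = kron_inc_transpose G B (vel (fst (z t))) e" for t v e
    by (simp_all add: y_def vec_field_def)
  have fy: "fst (vec_field (y t)) v = - (R v *v vel (fst (y t)) v) - kron_inc G B (\<lambda>e. W e *v snd (y t) e) v"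
    "snd (vec_field (y t)) e = kron_inc_transpose G B (vel (fst (y t))) e" for t v e
    by (simp_all add: vec_field_def)
  have "((\<lambda>s. fst (y s) v) has_vector_derivative fst (vec_field (y t)) v) (at t within {0..})"
    if "t \<ge> 0" "v \<in> pverts G" for t v
    unfolding fy y
    by (intro has_vector_derivative_diff has_vector_derivative_minus kron_inc_derivative
        bounded_linear.has_vector_derivative[OF matrix_vector_mul_bounded_linear]
        vel_derivative[OF z that, folded y_def, unfolded y] solution_derivative(2)[OF z that(1), folded y_def, unfolded y])
  moreover have "((\<lambda>s. snd (y s) e) has_vector_derivative snd (vec_field (y t)) e) (at t within {0..})"
    if "t \<ge> 0" for t e
    unfolding fy y by (intro kron_inc_transpose_derivative vel_derivative[OF z that, folded y_def, unfolded y])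
  ultimately show ?thesis
    unfolding is_solution_iff y_def[symmetric] by blast
qed

lemma is_solution_vec_field_pow:
  "is_solution G B M W R z \<Longrightarrow> is_solution G B M W R (\<lambda>t. (vec_field ^^ k) (z t))"
  by (induction k) (auto intro: is_solution_vec_field)

section \<open>Energy and dissipation\<close>

definition energy :: "('v, 'r) state \<Rightarrow> real" where
  "energy z = (\<Sum>v\<in>pverts G. fst z v \<bullet> vel (fst z) v) + (\<Sum>e\<in>edges G. snd z e \<bullet> (W e *v snd z e))"

definition dissipation :: "('v, 'r) state \<Rightarrow> real" where
  "dissipation z = (\<Sum>v\<in>pverts G. vel (fst z) v \<bullet> (R v *v vel (fst z) v))"

lemma dissipation_nonneg: "dissipation z \<ge> 0"
  unfolding dissipation_def using R_semidef by (intro sum_nonneg) (auto simp: sym_pos_semidef_def)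

text \<open>All summands are nonnegative, so each one vanishes. Semidefiniteness then removes the
  damping force everywhere, and definiteness removes the velocity at damped nodes.\<close>

lemma dissipation_eq_0:
  assumes "dissipation z = 0" "v \<in> pverts G"
  shows "R v *v vel (fst z) v = 0" "v \<in> Vd \<Longrightarrow> vel (fst z) v = 0"
proof -
  have "\<forall>v\<in>pverts G. vel (fst z) v \<bullet> (R v *v vel (fst z) v) = 0"
    using assms(1) R_semidef unfolding dissipation_def
    by (subst (asm) sum_nonneg_eq_0_iff) (auto simp: sym_pos_semidef_def)
  then have 0: "vel (fst z) v \<bullet> (R v *v vel (fst z) v) = 0"
    using assms by blast
  then show "R v *v vel (fst z) v = 0"
    by (rule sym_pos_semidef_null[OF R_semidef[OF assms(2)]])
  show "vel (fst z) v = 0" if "v \<in> Vd"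
    using that 0 feasible unfolding feasible_def sym_pos_def_def by (metis less_irrefl)
qed

text \<open>The energy is a diagonal quadratic form whose finitely many coefficients
  \<open>1 / M v $ i $ i\<close> and \<open>W e $ i $ i\<close> are positive.\<close>

lemma energy_bounds:
  obtains c C where "c > 0" "C > 0"
    "\<forall>z. c * (state_norm G z)\<^sup>2 \<le> energy z \<and> energy z \<le> C * (state_norm G z)\<^sup>2"
proof -
  obtain c1 C1 where 1: "c1 > 0" "C1 > 0"
    "\<And>vi. vi \<in> pverts G \<times> UNIV \<Longrightarrow> c1 \<le> 1 / M (fst vi) $ snd vi $ snd vi \<and> 1 / M (fst vi) $ snd vi $ snd vi \<le> C1"
    by (rule finite_positive_bounds[of "pverts G \<times> UNIV" "\<lambda>vi. 1 / M (fst vi) $ snd vi $ snd vi"])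
      (auto simp: M_pos)
  obtain c2 C2 where 2: "c2 > 0" "C2 > 0"
    "\<And>ei. ei \<in> edges G \<times> UNIV \<Longrightarrow> c2 \<le> W (fst ei) $ snd ei $ snd ei \<and> W (fst ei) $ snd ei $ snd ei \<le> C2"
    by (rule finite_positive_bounds[of "edges G \<times> UNIV" "\<lambda>ei. W (fst ei) $ snd ei $ snd ei"])
      (auto simp: finite_edges W_pos)
  define c where "c = min c1 c2"
  define C where "C = max C1 C2"
  have form: "c * (norm x)\<^sup>2 \<le> x \<bullet> y \<and> x \<bullet> y \<le> C * (norm x)\<^sup>2"
    if "\<And>i. y $ i = a i * x $ i" "\<And>i. c \<le> a i \<and> a i \<le> C" for x y :: "real ^ 'r" and a
  proof -
    have "x \<bullet> y = (\<Sum>i\<in>UNIV. a i * (x $ i)\<^sup>2)"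
      by (simp add: inner_vec_def that(1) power2_eq_square mult_ac)
    moreover have "(norm x)\<^sup>2 = (\<Sum>i\<in>UNIV. (x $ i)\<^sup>2)"
      unfolding power2_norm_eq_inner by (simp add: inner_vec_def power2_eq_square)
    ultimately show ?thesis
      using that(2) by (auto simp: sum_distrib_left intro!: sum_mono mult_right_mono)
  qed
  have P: "c * (norm (p v))\<^sup>2 \<le> p v \<bullet> vel p v \<and> p v \<bullet> vel p v \<le> C * (norm (p v))\<^sup>2" if v: "v \<in> pverts G" for p v
  proof (rule form)
    show "vel p v $ i = (1 / M v $ i $ i) * p v $ i" for i
      by (simp add: vel_nth[OF v])
    show "c \<le> 1 / M v $ i $ i \<and> 1 / M v $ i $ i \<le> C" for i
      using 1(3)[of "(v, i)"] v by (auto simp: c_def C_def)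
  qed
  have Q: "c * (norm (q e))\<^sup>2 \<le> q e \<bullet> (W e *v q e) \<and> q e \<bullet> (W e *v q e) \<le> C * (norm (q e))\<^sup>2"
    if e: "e \<in> edges G" for q e
  proof (rule form)
    show "(W e *v q e) $ i = W e $ i $ i * q e $ i" for i
      by (rule diagonal_matrix_mult_nth[OF W_diag[OF e]])
    show "c \<le> W e $ i $ i \<and> W e $ i $ i \<le> C" for i
      using 2(3)[of "(e, i)"] e by (auto simp: c_def C_def)
  qed
  have sq: "(state_norm G z)\<^sup>2 = (\<Sum>v\<in>pverts G. (norm (fst z v))\<^sup>2) + (\<Sum>e\<in>edges G. (norm (snd z e))\<^sup>2)" for z :: "('v, 'r) state"
    unfolding state_norm_def by (simp add: sum_nonneg)
  show thesis
  proof
    show "c > 0" "C > 0"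
      using 1 2 by (auto simp: c_def C_def)
    show "\<forall>z. c * (state_norm G z)\<^sup>2 \<le> energy z \<and> energy z \<le> C * (state_norm G z)\<^sup>2"
      unfolding sq energy_def distrib_left sum_distrib_left
      using P Q by (auto intro!: add_mono sum_mono)
  qed
qed

text \<open>The power exchanged between momenta and edge variables cancels because the two incidence
  operators are adjoint. The factor \<open>2\<close> appears because \<open>energy\<close> is twice
  the physical energy.\<close>

lemma energy_derivative:
  assumes z: "is_solution G B M W R z" and t: "t \<ge> 0"
  shows "((\<lambda>s. energy (z s)) has_real_derivative - (2 * dissipation (z t))) (at t within {0..})"
proof -
  define p where "p = fst (z t)"
  define q where "q = snd (z t)"
  define p' where "p' = fst (vec_field (z t))"
  define q' where "q' = snd (vec_field (z t))"
  have W_sym: "x \<bullet> (W e *v y) = (W e *v x) \<bullet> y" if "e \<in> edges G" for e x y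
    by (simp add: inner_vec_def diagonal_matrix_mult_nth[OF W_diag[OF that]] mult_ac)
  have "((\<lambda>s. energy (z s)) has_vector_derivative
      (\<Sum>v\<in>pverts G. p v \<bullet> vel p' v + p' v \<bullet> vel p v) + (\<Sum>e\<in>edges G. q e \<bullet> (W e *v q' e) + q' e \<bullet> (W e *v q e)))
      (at t within {0..})"
    unfolding energy_def p_def q_def p'_def q'_def
    by (intro has_vector_derivative_add has_vector_derivative_sum
        bounded_bilinear.has_vector_derivative[OF bounded_bilinear_inner]
        bounded_linear.has_vector_derivative[OF matrix_vector_mul_bounded_linear]
        vel_derivative[OF z t] solution_derivative[OF z t])
  moreover have "(\<Sum>v\<in>pverts G. p v \<bullet> vel p' v + p' v \<bullet> vel p v) = 2 * (\<Sum>v\<in>pverts G. vel p v \<bullet> p' v)"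
    unfolding sum_distrib_left
  proof (rule sum.cong[OF refl])
    show "p v \<bullet> vel p' v + p' v \<bullet> vel p v = 2 * (vel p v \<bullet> p' v)" if "v \<in> pverts G" for v
      using vel_symmetric[OF that, of p p'] inner_commute[of "p' v" "vel p v"] by linarith
  qed
  moreover have "(\<Sum>e\<in>edges G. q e \<bullet> (W e *v q' e) + q' e \<bullet> (W e *v q e)) = 2 * (\<Sum>e\<in>edges G. q' e \<bullet> (W e *v q e))"
    unfolding sum_distrib_left
  proof (rule sum.cong[OF refl])
    show "q e \<bullet> (W e *v q' e) + q' e \<bullet> (W e *v q e) = 2 * (q' e \<bullet> (W e *v q e))" if "e \<in> edges G" for e
      using W_sym[OF that, of "q e" "q' e"] inner_commute[of "W e *v q e" "q' e"] by linarith
  qed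
  moreover have "(\<Sum>v\<in>pverts G. vel p v \<bullet> p' v)
      = - dissipation (z t) - (\<Sum>v\<in>pverts G. vel p v \<bullet> kron_inc G B (\<lambda>e. W e *v q e) v)"
    unfolding dissipation_def p'_def p_def q_def vec_field_def
    by (simp add: inner_diff_right sum_subtractf sum_negf)
  moreover have "q' = kron_inc_transpose G B (vel p)"
    by (simp add: q'_def p_def vec_field_def)
  ultimately show ?thesis
    unfolding has_real_derivative_iff_has_vector_derivative kron_inc_adjoint by (simp add: algebra_simps)
qed

lemma energy_nonneg: "energy z \<ge> 0"
proof -
  obtain c C where c: "c > 0" "\<forall>z. c * (state_norm G z)\<^sup>2 \<le> energy z \<and> energy z \<le> C * (state_norm G z)\<^sup>2"
    using energy_bounds by blast
  have "0 \<le> c * (state_norm G z)\<^sup>2"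
    using c(1) by simp
  then show ?thesis
    using c(2) order_trans by blast
qed

lemma energy_antimono:
  assumes z: "is_solution G B M W R z" and t: "t \<ge> 0"
  shows "energy (z t) \<le> energy (z 0)"
proof -
  have "\<exists>s\<in>{0..t}. energy (z t) - energy (z 0) = - (2 * dissipation (z s)) * (t - 0)"
    using energy_derivative[OF z] t by (intro mvt_half_line) auto
  then obtain s where "energy (z t) - energy (z 0) = - (2 * dissipation (z s)) * t"
    by auto
  moreover have "dissipation (z s) * t \<ge> 0"
    using dissipation_nonneg t by simp
  ultimately show ?thesis
    by simp
qed

lemma norm_le_state_norm:
  "v \<in> pverts G \<Longrightarrow> norm (fst z v) \<le> state_norm G z" "e \<in> edges G \<Longrightarrow> norm (snd z e) \<le> state_norm G z"
proof -
  assume "v \<in> pverts G"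
  then have "(norm (fst z v))\<^sup>2 \<le> (\<Sum>v\<in>pverts G. (norm (fst z v))\<^sup>2)"
    by (intro member_le_sum) auto
  then show "norm (fst z v) \<le> state_norm G z"
    unfolding state_norm_def by (intro real_le_rsqrt add_increasing2 sum_nonneg) auto
next
  assume "e \<in> edges G"
  then have "(norm (snd z e))\<^sup>2 \<le> (\<Sum>e\<in>edges G. (norm (snd z e))\<^sup>2)"
    by (intro member_le_sum) (auto simp: finite_edges)
  then show "norm (snd z e) \<le> state_norm G z"
    unfolding state_norm_def by (intro real_le_rsqrt add_increasing sum_nonneg) auto
qed

lemma state_norm_nonneg: "state_norm G z \<ge> 0"
  unfolding state_norm_def by (intro real_sqrt_ge_zero add_nonneg_nonneg sum_nonneg) auto

text \<open>The energy does not increase and is comparable to the squared norm. The constant is the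
  same for all solutions, which gives Lyapunov stability.\<close>

lemma solution_norm_bound:
  obtains K where "K > 0"
    "\<And>z t. is_solution G B M W R z \<Longrightarrow> t \<ge> 0 \<Longrightarrow> state_norm G (z t) \<le> K * state_norm G (z 0)"
proof -
  obtain c C where c: "c > 0" "C > 0"
    "\<forall>z. c * (state_norm G z)\<^sup>2 \<le> energy z \<and> energy z \<le> C * (state_norm G z)\<^sup>2"
    using energy_bounds by blast
  have "state_norm G (z t) \<le> sqrt (C / c) * state_norm G (z 0)"
    if "is_solution G B M W R z" "t \<ge> 0" for z t
  proof -
    have "c * (state_norm G (z t))\<^sup>2 \<le> C * (state_norm G (z 0))\<^sup>2"
      using c(3)[rule_format, of "z t"] c(3)[rule_format, of "z 0"] energy_antimono[OF that] by linarith
    then have "(state_norm G (z t))\<^sup>2 \<le> (sqrt (C / c) * state_norm G (z 0))\<^sup>2"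
      using c by (simp add: field_simps)
    then show ?thesis
      using c by (intro power2_le_imp_le[OF _ mult_nonneg_nonneg]) (auto simp: state_norm_nonneg)
  qed
  then show thesis
    using that[of "sqrt (C / c)"] c by simp
qed

text \<open>Barbalat's argument with the energy as \<open>H\<close>. The dissipation is quadratic in
  the momenta; these and their derivatives are bounded, since both belong to solutions, and so its
  derivative is bounded.\<close>

lemma dissipation_tendsto_0:
  assumes z: "is_solution G B M W R z"
  shows "((\<lambda>t. dissipation (z t)) \<longlongrightarrow> 0) at_top"
proof -
  obtain K where K: "K > 0"
    "\<And>z t. is_solution G B M W R z \<Longrightarrow> t \<ge> 0 \<Longrightarrow> state_norm G (z t) \<le> K * state_norm G (z 0)"
    using solution_norm_bound by blast
  define b where "b = K * state_norm G (z 0)"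
  define b' where "b' = K * state_norm G (vec_field (z 0))"
  define D where "D v x y = (matrix_inv (M v) *v x) \<bullet> (R v *v (matrix_inv (M v) *v y))" for v x y
  have D: "bounded_bilinear (D v)" for v
    unfolding D_def
    by (intro bounded_bilinear.comp[OF bounded_bilinear_inner] matrix_vector_mul_bounded_linear
        bounded_linear_compose[OF matrix_vector_mul_bounded_linear])
  then have "\<forall>v. \<exists>k>0. \<forall>x y. norm (D v x y) \<le> norm x * norm y * k"
    using bounded_bilinear.pos_bounded by blast
  then obtain k where k: "\<And>v. k v > 0" "\<And>v x y. norm (D v x y) \<le> norm x * norm y * k v"
    by metis
  have diss: "dissipation z = (\<Sum>v\<in>pverts G. D v (fst z v) (fst z v))" for z
    by (simp add: dissipation_def D_def vel_def)
  define g' where "g' t = (\<Sum>v\<in>pverts G. D v (fst (z t) v) (fst (vec_field (z t)) v)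
    + D v (fst (vec_field (z t)) v) (fst (z t) v))" for t
  have "((\<lambda>t. 2 * dissipation (z t)) \<longlongrightarrow> 0) at_top"
  proof (rule nonneg_dissipation_tendsto_0)
    show "((\<lambda>s. energy (z s)) has_real_derivative - (2 * dissipation (z t))) (at t within {0..})" if "t \<ge> 0" for t
      by (rule energy_derivative[OF z that])
    show "energy (z t) \<ge> 0" "2 * dissipation (z t) \<ge> 0" for t
      using energy_nonneg dissipation_nonneg by auto
    show "((\<lambda>t. 2 * dissipation (z t)) has_real_derivative 2 * g' t) (at t within {0..})" if "t \<ge> 0" for t
      unfolding has_real_derivative_iff_has_vector_derivative diss g'_def
      by (intro bounded_linear.has_vector_derivative[OF bounded_linear_mult_right] has_vector_derivative_sum
          bounded_bilinear.has_vector_derivative[OF D] solution_derivative(1)[OF z that])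
    show "\<bar>2 * g' t\<bar> \<le> 2 * (\<Sum>v\<in>pverts G. b * b' * k v + b' * b * k v)" if t: "t \<ge> 0" for t
    proof -
      have p: "norm (fst (z t) v) \<le> b" "norm (fst (vec_field (z t)) v) \<le> b'" if "v \<in> pverts G" for v
        using norm_le_state_norm(1)[OF that, of "z t"] norm_le_state_norm(1)[OF that, of "vec_field (z t)"]
          K(2)[OF z t] K(2)[OF is_solution_vec_field[OF z] t]
        by (auto simp: b_def b'_def intro: order_trans)
      have b0: "b \<ge> 0" "b' \<ge> 0"
        unfolding b_def b'_def by (intro mult_nonneg_nonneg less_imp_le[OF K(1)] state_norm_nonneg)+
      have *: "norm (D v x y) \<le> r * s * k v" if "norm x \<le> r" "norm y \<le> s" for v x y r s
        using that k(1)[of v] order_trans[OF norm_ge_zero that(1)]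
        by (intro order_trans[OF k(2)] mult_right_mono mult_mono) auto
      have "\<bar>g' t\<bar> \<le> (\<Sum>v\<in>pverts G. b * b' * k v + b' * b * k v)"
        unfolding g'_def real_norm_def[symmetric] using p
        by (intro order_trans[OF norm_sum] sum_mono order_trans[OF norm_triangle_ineq] add_mono *)
      then show ?thesis
        by simp
    qed
  qed
  from tendsto_mult_left[OF this, of "1 / 2"] show ?thesis
    by simp
qed

section \<open>Invariance and closedness of \<open>Omega\<close>\<close>

lemma Omega_invariant:
  assumes z: "is_solution G B M W R z" and z0: "z 0 \<in> Omega G B" and t: "t \<ge> 0"
  shows "z t \<in> Omega G B"
proof -
  obtain c :: "'v \<Rightarrow> 'v set \<Rightarrow> real" where
    c: "\<forall>q :: 'v set \<Rightarrow> real ^ 'r. (\<exists>x. \<forall>e\<in>edges G. q e = kron_inc_transpose G B x e) \<longleftrightarrow>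
      (\<forall>e\<in>edges G. q e = kron_inc_transpose G B (\<lambda>v. \<Sum>e\<in>edges G. c v e *\<^sub>R q e) e)"
    using Omega_equations .
  \<comment> \<open>The defect of \<open>q\<close> in the equations of \<open>Omega\<close>. It is
    linear and vanishes on the vector field, whose edge part is in the image of the transposed
    incidence operator; so it is constant along solutions.\<close>
  define F where "F e q = q e - kron_inc_transpose G B (\<lambda>v. \<Sum>e\<in>edges G. c v e *\<^sub>R q e) e"
    for e and q :: "'v set \<Rightarrow> real ^ 'r"
  have F: "z \<in> Omega G B \<longleftrightarrow> (\<forall>e\<in>edges G. F e (snd z) = 0)" for z :: "('v, 'r) state"
    using c unfolding Omega_def F_def by (cases z) (simp only: mem_Collect_eq prod.case snd_conv right_minus_eq)
  have "F e (snd (z t)) = 0" if e: "e \<in> edges G" for e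
  proof -
    have "((\<lambda>s. F e (snd (z s))) has_vector_derivative 0) (at s within {0..})" if s: "s \<in> {0..}" for s
    proof -
      have "((\<lambda>s. F e (snd (z s))) has_vector_derivative F e (snd (vec_field (z s)))) (at s within {0..})"
        unfolding F_def using s e
        by (intro has_vector_derivative_diff kron_inc_transpose_derivative has_vector_derivative_sum
            bounded_linear.has_vector_derivative[OF bounded_linear_scaleR_right] solution_derivative(2)[OF z]) auto
      moreover have "vec_field (z s) \<in> Omega G B"
        by (auto simp: Omega_def vec_field_def)
      ultimately show ?thesis
        using F e by simp
    qed
    then obtain k where "\<And>s. s \<in> {0..} \<Longrightarrow> F e (snd (z s)) = k"
      using has_vector_derivative_zero_constant[of "{0..}" "\<lambda>s. F e (snd (z s))"] by auto
    moreover have "F e (snd (z 0)) = 0"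
      using F z0 e by blast
    ultimately show ?thesis
      using t by simp
  qed
  then show ?thesis
    using F by blast
qed

lemma Omega_closed:
  assumes lim: "\<And>e. e \<in> edges G \<Longrightarrow> (\<lambda>n. snd (Z n) e) \<longlonglongrightarrow> snd L e"
    and Z: "\<And>n. Z n \<in> Omega G B"
  shows "(L :: ('v, 'r) state) \<in> Omega G B"
proof -
  obtain c :: "'v \<Rightarrow> 'v set \<Rightarrow> real" where
    c: "\<forall>q :: 'v set \<Rightarrow> real ^ 'r. (\<exists>x. \<forall>e\<in>edges G. q e = kron_inc_transpose G B x e) \<longleftrightarrow>
      (\<forall>e\<in>edges G. q e = kron_inc_transpose G B (\<lambda>v. \<Sum>e\<in>edges G. c v e *\<^sub>R q e) e)"
    using Omega_equations .
  have "snd L e = kron_inc_transpose G B (\<lambda>v. \<Sum>e\<in>edges G. c v e *\<^sub>R snd L e) e" if e: "e \<in> edges G" for e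
  proof (rule LIMSEQ_unique[OF lim[OF e]])
    have eq: "snd (Z n) e = kron_inc_transpose G B (\<lambda>v. \<Sum>e\<in>edges G. c v e *\<^sub>R snd (Z n) e) e" for n
      using c Z[of n] e by (auto simp: Omega_def)
    show "(\<lambda>n. snd (Z n) e) \<longlonglongrightarrow> kron_inc_transpose G B (\<lambda>v. \<Sum>e\<in>edges G. c v e *\<^sub>R snd L e) e"
      by (subst eq, unfold kron_inc_transpose_def) (intro tendsto_intros lim)
  qed
  then have "\<exists>x. \<forall>e\<in>edges G. snd L e = kron_inc_transpose G B x e"
    by blast
  then show ?thesis
    by (cases L) (simp add: Omega_def)
qed

lemma vec_field_pow_tendsto:
  assumes "\<And>v. v \<in> pverts G \<Longrightarrow> (\<lambda>n. fst (Z n) v) \<longlonglongrightarrow> fst L v"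
    "\<And>e. e \<in> edges G \<Longrightarrow> (\<lambda>n. snd (Z n) e) \<longlonglongrightarrow> snd L e"
  shows "v \<in> pverts G \<Longrightarrow> (\<lambda>n. fst ((vec_field ^^ k) (Z n)) v) \<longlonglongrightarrow> fst ((vec_field ^^ k) L) v"
    and "e \<in> edges G \<Longrightarrow> (\<lambda>n. snd ((vec_field ^^ k) (Z n)) e) \<longlonglongrightarrow> snd ((vec_field ^^ k) L) e"
proof (induction k arbitrary: v e)
  case (Suc k)
  have vel: "(\<lambda>n. vel (fst ((vec_field ^^ k) (Z n))) v) \<longlonglongrightarrow> vel (fst ((vec_field ^^ k) L)) v"
    if "v \<in> pverts G" for v
    unfolding vel_def using Suc.IH(1)[OF that]
    by (rule bounded_linear.tendsto[OF matrix_vector_mul_bounded_linear])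
  {
    case 1
    then show ?case
      unfolding funpow.simps comp_apply vec_field_def[of "(vec_field ^^ k) _"] fst_conv kron_inc_def
      by (intro tendsto_intros bounded_linear.tendsto[OF matrix_vector_mul_bounded_linear] vel Suc.IH(2))
  next
    case 2
    then show ?case
      unfolding funpow.simps comp_apply vec_field_def[of "(vec_field ^^ k) _"] snd_conv kron_inc_transpose_def
      by (intro tendsto_intros vel)
  }
qed (use assms in simp_all)

section \<open>Undamped trajectories\<close>

lemma laplacian_scale: "laplacian w (\<lambda>u. a * f u) v = a * laplacian w f v"
  unfolding laplacian_def sum_distrib_left by (intro sum.cong) (simp_all add: algebra_simps)

text \<open>
  Along an undamped trajectory the velocities satisfy \<open>x'' = - M\<^sup>-\<^sup>1 L x\<close>, which decouples into
  scalar systems because \<open>M\<close> and \<open>W\<close> are diagonal.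
\<close>

lemma undamped_velocity_step:
  assumes diss: "\<And>k. dissipation ((vec_field ^^ k) L) = 0" and v: "v \<in> pverts G"
  shows "vel (fst ((vec_field ^^ Suc (Suc k)) L)) v $ i
    = - stiffness (\<lambda>e. W e $ i $ i) (\<lambda>v. M v $ i $ i) (\<lambda>u. vel (fst ((vec_field ^^ k) L)) u $ i) v"
proof -
  define y where "y = (vec_field ^^ k) L"
  have "R v *v vel (fst (vec_field y)) v = 0"
    using dissipation_eq_0(1)[OF diss[of "Suc k"] v] by (simp add: y_def)
  then have "fst (vec_field (vec_field y)) v = - kron_inc G B (\<lambda>e. W e *v snd (vec_field y) e) v"
    by (subst vec_field_def) simp
  also have "\<dots> = - (\<Sum>u\<in>neighbors G v. W {v, u} *v (vel (fst y) v - vel (fst y) u))"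
    unfolding vec_field_def[of y] snd_conv kron_inc_weighted[OF v] ..
  finally have eq: "fst (vec_field (vec_field y)) v = - (\<Sum>u\<in>neighbors G v. W {v, u} *v (vel (fst y) v - vel (fst y) u))" .
  have "fst (vec_field (vec_field y)) v $ i = - laplacian (\<lambda>e. W e $ i $ i) (\<lambda>u. vel (fst y) u $ i) v"
    unfolding eq laplacian_def uminus_vec_def sum_component vec_lambda_beta
    by (intro arg_cong[where f = uminus] sum.cong refl)
      (simp add: diagonal_matrix_mult_nth[OF W_diag[OF neighborD(5)]])
  then show ?thesis
    by (simp add: vel_nth[OF v] stiffness_def y_def)
qed

text \<open>In each scalar component the iterates of \<open>stiffness\<close> are, up to sign, the
  time derivatives of even order. They vanish at the damped nodes, so a nonzero component would be
  unobservable and yield a richly balanced coloring.\<close>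

lemma undamped_velocity_eq_0:
  assumes diss: "\<And>k. dissipation ((vec_field ^^ k) L) = 0"
    and no_col: "\<not> (\<exists>c. coloring Vd c \<and> richly_balanced G c)" and v: "v \<in> pverts G"
  shows "vel (fst ((vec_field ^^ k) L)) v = 0"
proof -
  define X where "X k i v = vel (fst ((vec_field ^^ k) L)) v $ i" for k i v
  have pow: "(stiffness (\<lambda>e. W e $ i $ i) (\<lambda>v. M v $ i $ i) ^^ j) (X k i) v = (-1) ^ j * X (2 * j + k) i v"
    if "v \<in> pverts G" for i j v
    using that
  proof (induction j arbitrary: v)
    case (Suc j)
    let ?S = "stiffness (\<lambda>e. W e $ i $ i) (\<lambda>v. M v $ i $ i)"
    have "(?S ^^ Suc j) (X k i) v = ?S (\<lambda>u. (-1) ^ j * X (2 * j + k) i u) v"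
      using laplacian_cong[OF Suc.IH Suc.prems] by (simp add: stiffness_def[of _ _ "(?S ^^ j) _"] stiffness_def[of _ _ "\<lambda>u. _ * _ u"])
    also have "\<dots> = (-1) ^ j * ?S (X (2 * j + k) i) v"
      by (simp add: stiffness_def laplacian_scale)
    also have "\<dots> = (-1) ^ j * - X (Suc (Suc (2 * j + k))) i v"
      using undamped_velocity_step[OF diss Suc.prems, of "2 * j + k" i] by (simp add: X_def[abs_def])
    finally show ?case
      by simp
  qed simp
  have "X k i v = 0" for i
  proof (rule ccontr)
    assume "X k i v \<noteq> 0"
    then have "\<exists>v\<in>pverts G. X k i v \<noteq> 0"
      using v by blast
    moreover have "(stiffness (\<lambda>e. W e $ i $ i) (\<lambda>v. M v $ i $ i) ^^ j) (X k i) u = 0" if "u \<in> Vd" for j u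
    proof -
      have u: "u \<in> pverts G"
        using damped that by blast
      show ?thesis
        unfolding pow[OF u] using dissipation_eq_0(2)[OF diss u that] by (simp add: X_def)
    qed
    ultimately show False
      using unobservable_richly_balanced[of "\<lambda>e. W e $ i $ i" "\<lambda>v. M v $ i $ i" "X k i"] no_col W_pos M_pos
      by blast
  qed
  then show ?thesis
    by (simp add: vec_eq_iff X_def)
qed

text \<open>The cases \<open>k = 0\<close> and \<open>k = 1\<close> make velocities and
  accelerations vanish, so the edge forces balance at every node. Membership in \<open>Omega\<close>
  writes the edge part as the image of some \<open>x\<close>, and adjointness makes its energy the
  pairing of \<open>x\<close> with the zero net force.\<close>

lemma undamped_energy_eq_0:
  assumes diss: "\<And>k. dissipation ((vec_field ^^ k) L) = 0"
    and no_col: "\<not> (\<exists>c. coloring Vd c \<and> richly_balanced G c)" and L: "L \<in> Omega G B"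
  shows "energy L = 0"
proof -
  have vel0: "vel (fst L) v = 0" if "v \<in> pverts G" for v
    using undamped_velocity_eq_0[OF diss no_col that, of 0] by simp
  have "vel (fst (vec_field L)) v = 0" if "v \<in> pverts G" for v
    using undamped_velocity_eq_0[OF diss no_col that, of 1] by simp
  then have acc: "fst (vec_field L) v = 0" if "v \<in> pverts G" for v
    using that vel_eq_0_iff by blast
  have force: "kron_inc G B (\<lambda>e. W e *v snd L e) v = 0" if "v \<in> pverts G" for v
    using acc[OF that] vel0[OF that] by (simp add: vec_field_def)
  obtain x where x: "\<forall>e\<in>edges G. snd L e = kron_inc_transpose G B x e"
  proof -
    have "\<exists>x. \<forall>e\<in>edges G. snd L e = kron_inc_transpose G B x e"
      using L by (cases L) (simp add: Omega_def)
    then show thesis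
      using that by blast
  qed
  have "(\<Sum>e\<in>edges G. snd L e \<bullet> (W e *v snd L e)) = (\<Sum>e\<in>edges G. kron_inc_transpose G B x e \<bullet> (W e *v snd L e))"
    using x by (intro sum.cong) auto
  also have "\<dots> = 0"
    unfolding kron_inc_adjoint[symmetric] using force by simp
  finally show ?thesis
    by (simp add: energy_def vel0)
qed

section \<open>Convergence and stability of the origin\<close>

lemma solution_tendsto_0:
  assumes no_col: "\<not> (\<exists>c. coloring Vd c \<and> richly_balanced G c)"
    and z: "is_solution G B M W R z" and z0: "z 0 \<in> Omega G B"
  shows "((\<lambda>t. state_norm G (z t)) \<longlongrightarrow> 0) at_top"
proof (rule ccontr)
  assume "\<not> ?thesis"
  then obtain \<epsilon> where \<epsilon>: "\<epsilon> > 0" "\<not> (\<forall>\<^sub>F t in at_top. state_norm G (z t) < \<epsilon>)"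
    unfolding tendsto_iff dist_real_def diff_0_right abs_of_nonneg[OF state_norm_nonneg] by blast
  have "\<exists>t\<ge>real n. state_norm G (z t) \<ge> \<epsilon>" for n
    using \<epsilon>(2) unfolding eventually_at_top_linorder by (meson not_less)
  then obtain t where t: "\<And>n. t n \<ge> real n" "\<And>n. state_norm G (z (t n)) \<ge> \<epsilon>"
    by metis
  have t0: "t n \<ge> 0" for n
    using t(1)[of n] by (meson of_nat_0_le_iff order_trans)
  have t_lim: "filterlim t at_top sequentially"
    using t(1) by (intro filterlim_at_top_mono[OF filterlim_real_sequentially]) auto
  obtain K where K: "\<And>t. t \<ge> 0 \<Longrightarrow> state_norm G (z t) \<le> K"
    using solution_norm_bound z by metis
  \<comment> \<open>Node and edge components are merged into one finite family, so that a single
    subsequence serves both.\<close>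
  define f where "f n a = (case a of Inl v \<Rightarrow> fst (z (t n)) v | Inr e \<Rightarrow> snd (z (t n)) e)" for n a
  have "bounded (range (\<lambda>n. f n a))" if "a \<in> pverts G <+> edges G" for a
  proof (rule boundedI)
    show "norm y \<le> K" if "y \<in> range (\<lambda>n. f n a)" for y
      using that \<open>a \<in> _\<close> order_trans[OF norm_le_state_norm(1) K[OF t0]] order_trans[OF norm_le_state_norm(2) K[OF t0]]
      by (auto simp: f_def)
  qed
  with finite_Plus[OF pair_finite_verts finite_edges]
  obtain l r where r: "strict_mono (r :: nat \<Rightarrow> nat)"
    and l: "\<And>a. a \<in> pverts G <+> edges G \<Longrightarrow> (\<lambda>n. f (r n) a) \<longlonglongrightarrow> l a"
    using bounded_family_convergent_subseq[of "pverts G <+> edges G" f] by blast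
  define L where "L = (\<lambda>v. l (Inl v), \<lambda>e. l (Inr e))"
  define Z where "Z n = z (t (r n))" for n
  have lim: "v \<in> pverts G \<Longrightarrow> (\<lambda>n. fst (Z n) v) \<longlonglongrightarrow> fst L v"
    "e \<in> edges G \<Longrightarrow> (\<lambda>n. snd (Z n) e) \<longlonglongrightarrow> snd L e" for v e
    using l[of "Inl v"] l[of "Inr e"] by (auto simp: f_def L_def Z_def)
  \<comment> \<open>The iterates along \<open>z\<close> are themselves solutions, so their
    dissipation tends to \<open>0\<close>; by continuity it also tends to its value at the limit
    point.\<close>
  have "dissipation ((vec_field ^^ k) L) = 0" for k
  proof (rule LIMSEQ_unique)
    show "(\<lambda>n. dissipation ((vec_field ^^ k) (Z n))) \<longlonglongrightarrow> dissipation ((vec_field ^^ k) L)"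
      unfolding dissipation_def vel_def
      by (intro tendsto_intros bounded_linear.tendsto[OF matrix_vector_mul_bounded_linear]
          vec_field_pow_tendsto(1)[OF lim])
    have "filterlim (\<lambda>n. t (r n)) at_top sequentially"
      by (rule filterlim_compose[OF t_lim filterlim_subseq[OF r]])
    from filterlim_compose[OF dissipation_tendsto_0[OF is_solution_vec_field_pow[OF z]] this]
    show "(\<lambda>n. dissipation ((vec_field ^^ k) (Z n))) \<longlonglongrightarrow> 0"
      by (simp add: Z_def)
  qed
  moreover have "Z n \<in> Omega G B" for n
    unfolding Z_def by (rule Omega_invariant[OF z z0 t0])
  then have "L \<in> Omega G B"
    using Omega_closed[OF lim(2)] by blast
  ultimately have E: "energy L = 0"
    using undamped_energy_eq_0[OF _ no_col] by blast
  \<comment> \<open>The sampling times keep the norm above \<open>\<epsilon>\<close>, so the limit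
    point inherits this bound and contradicts zero energy.\<close>
  have "(\<lambda>n. state_norm G (Z n)) \<longlonglongrightarrow> state_norm G L"
    unfolding state_norm_def by (intro tendsto_intros lim)
  then have "state_norm G L \<ge> \<epsilon>"
    by (rule LIMSEQ_le_const) (use t(2) in \<open>simp add: Z_def\<close>)
  moreover have "state_norm G L = 0"
  proof -
    obtain c C where "c > 0" "\<forall>z. c * (state_norm G z)\<^sup>2 \<le> energy z \<and> energy z \<le> C * (state_norm G z)\<^sup>2"
      using energy_bounds by blast
    then have "c * (state_norm G L)\<^sup>2 \<le> 0"
      using E by metis
    then show ?thesis
      using \<open>c > 0\<close> by (simp add: mult_le_0_iff)
  qed
  ultimately show False
    using \<epsilon>(1) by simp
qed

lemma origin_stable:
  assumes "\<not> (\<exists>c. coloring Vd c \<and> richly_balanced G c)"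
  shows "origin_GAS (state_norm G) {z. is_solution G B M W R z \<and> z 0 \<in> Omega G B}"
proof -
  obtain K where K: "K > 0"
    "\<And>z t. is_solution G B M W R z \<Longrightarrow> t \<ge> 0 \<Longrightarrow> state_norm G (z t) \<le> K * state_norm G (z 0)"
    using solution_norm_bound by blast
  have "state_norm G (z t) < \<epsilon>" if "is_solution G B M W R z" "t \<ge> 0" "state_norm G (z 0) < \<epsilon> / K" for z t \<epsilon>
  proof -
    have "K * state_norm G (z 0) < \<epsilon>"
      using that(3) K(1) by (simp add: field_simps)
    then show ?thesis
      using K(2)[OF that(1,2)] by simp
  qed
  then have "\<exists>\<delta>>0. \<forall>z\<in>{z. is_solution G B M W R z \<and> z 0 \<in> Omega G B}.
      state_norm G (z 0) < \<delta> \<longrightarrow> (\<forall>t\<ge>0. state_norm G (z t) < \<epsilon>)" if "\<epsilon> > 0" for \<epsilon>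
    using that K(1) by (intro exI[of _ "\<epsilon> / K"]) auto
  then show ?thesis
    using solution_tendsto_0[OF assms] unfolding origin_GAS_def by blast
qed

end

theorem proposition5p7:
  fixes G :: "'v pair_pre_digraph" and Vd :: "'v set"
    and B :: "'v \<Rightarrow> 'v set \<Rightarrow> real"
  assumes "damping_graph G Vd"
    and "oriented_incidence_matrix G B"
  shows "(PI_GAS TYPE('r::finite) G Vd B \<longleftrightarrow> \<not> (\<exists>c. coloring Vd c \<and> richly_balanced G c)) \<and>
         (\<not> (\<exists>c. coloring Vd c \<and> richly_balanced G c) \<longleftrightarrow> uncolorable G Vd = pverts G)"
proof -
  interpret incidence_graph G Vd B
    using assms by unfold_locales
  have "origin_GAS (state_norm G) {z. is_solution G B M W R z \<and> z 0 \<in> Omega G B}"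
    if "\<not> (\<exists>c. coloring Vd c \<and> richly_balanced G c)" "feasible G Vd M W R"
    for M :: "'v \<Rightarrow> real ^ 'r ^ 'r" and W R
  proof -
    interpret feasible_system G Vd B M W R
      using that(2) by unfold_locales
    show ?thesis
      using that(1) by (rule origin_stable)
  qed
  then show ?thesis
    using not_PI_GAS_if_richly_balanced uncolorable_eq_pverts_iff unfolding PI_GAS_def by blast
qed

end
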